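(* Let $f:[0,\infty)\to\mathbb{R}$ be operator convex with $f(1)=0$. Let $\rho,\sigma$ be quantum states on a Hilbert space of finite dimension $n$, with $\sigma$ invertible. Let $\sigma^{-1/2}\rho\,\sigma^{-1/2}=\sum_{i=1}^n\lambda_i|u_i\rangle\langle u_i|$ be a spectral decomposition with $\lambda_i\ge0$ and orthonormal $|u_i\rangle$; put $s_i=\langle u_i|\sigma|u_i\rangle$ and $r_i=\lambda_i s_i$ (so that $(r_i)$ and $(s_i)$ are probability distributions), and regard them as the commuting states $r=\sum_i r_i|u_i\rangle\langle u_i|$ and $s=\sum_i s_i|u_i\rangle\langle u_i|$. Let $\mathcal{W}$ be any quantum channel such that $\mathcal{W}(s)$ is invertible. Then $$D_f^{\max}(\mathcal{W}(r)\|\mathcal{W}(s))\le D_f^{\max}(r\|s).$$ In other words, letting $\tilde\rho=\mathcal{W}(r)$ and $\tilde\sigma=\mathcal{W}(s)$, $$D_f^{\max}(\tilde\rho\|\tilde\sigma)\le D_f^{\max}(\rho\|\sigma).$$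
   Context: A quantum state is a positive semidefinite operator of trace $1$ on a finite-dimensional complex Hilbert space. A quantum channel is a completely positive trace-preserving linear map. For states $\rho,\sigma$ with $\sigma$ invertible, the maximal $f$-divergence is $D_f^{\max}(\rho\|\sigma)=\operatorname{Tr}\bigl(\sigma^{1/2} f(\sigma^{-1/2}\rho\,\sigma^{-1/2})\,\sigma^{1/2}\bigr)$, with $f$ applied by functional calculus. $f:[0,\infty)\to\mathbb{R}$ is operator convex if for all finite families of positive semidefinite operators $X_i$ (on any finite-dimensional Hilbert space) and reals $\lambda_i\ge0$ with $\sum_i\lambda_i=1$, one has $f(\sum_i\lambda_iX_i)\le\sum_i\lambda_i f(X_i)$ in the Loewner order. *)

theory Defs
  imports "Jordan_Normal_Form.Schur_Decomposition"
begin

text \<open>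
  A Hilbert space of dimension \<open>n\<close> is represented as \<open>\<complex>\<^sup>n\<close> and its operators as
  \<^term>\<open>carrier_mat n n :: complex mat set\<close>. The library's inner product \<^term>\<open>v \<bullet>c w\<close> is
  conjugate-linear in \<open>w\<close>, so that \<open>\<langle>v|A|v\<rangle>\<close> is \<open>(A *\<^sub>v v) \<bullet>c v\<close>.
\<close>

definition trace_mat :: "complex mat \<Rightarrow> complex" where
  "trace_mat A = (\<Sum>i<dim_row A. A $$ (i, i))"

definition hermitian_mat :: "complex mat \<Rightarrow> bool" where
  "hermitian_mat A \<longleftrightarrow> mat_adjoint A = A"

definition unitary_mat :: "nat \<Rightarrow> complex mat \<Rightarrow> bool" where
  "unitary_mat n U \<longleftrightarrow> U \<in> carrier_mat n n \<and>
     U * mat_adjoint U = 1\<^sub>m n \<and> mat_adjoint U * U = 1\<^sub>m n"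

definition psd :: "nat \<Rightarrow> complex mat \<Rightarrow> bool" where
  "psd n A \<longleftrightarrow> A \<in> carrier_mat n n \<and> hermitian_mat A \<and>
     (\<forall>v \<in> carrier_vec n. 0 \<le> Re ((A *\<^sub>v v) \<bullet>c v))"

definition loewner_le :: "nat \<Rightarrow> complex mat \<Rightarrow> complex mat \<Rightarrow> bool" where
  "loewner_le n A B \<longleftrightarrow> A \<in> carrier_mat n n \<and> B \<in> carrier_mat n n \<and> psd n (B - A)"

definition quantum_state :: "nat \<Rightarrow> complex mat \<Rightarrow> bool" where
  "quantum_state n \<rho> \<longleftrightarrow> psd n \<rho> \<and> trace_mat \<rho> = 1"

definition mat_sum :: "nat \<Rightarrow> ('i \<Rightarrow> complex mat) \<Rightarrow> 'i set \<Rightarrow> complex mat" where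
  "mat_sum n A I = mat n n (\<lambda>(i, j). \<Sum>k\<in>I. A k $$ (i, j))"

text \<open>The rank-one operator \<open>|u\<rangle>\<langle>v|\<close>.\<close>

definition ketbra :: "complex vec \<Rightarrow> complex vec \<Rightarrow> complex mat" where
  "ketbra u v = mat (dim_vec u) (dim_vec v) (\<lambda>(i, j). u $ i * cnj (v $ j))"

text \<open>
  Functional calculus for Hermitian matrices: if \<open>A = U diag(d) U\<^sup>*\<close> with \<open>U\<close> unitary and \<open>d\<close> real,
  then \<open>f(A) = U diag(f \<circ> d) U\<^sup>*\<close>. The result does not depend on the chosen diagonalisation. Only
  the values of \<open>f\<close> on the spectrum of \<open>A\<close> matter, so a function on \<open>[0,\<infinity>)\<close> applied to
  positive semidefinite matrices can be given as a total function on \<^typ>\<open>real\<close>.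
\<close>

definition fun_calc :: "(real \<Rightarrow> real) \<Rightarrow> complex mat \<Rightarrow> complex mat" where
  "fun_calc f A = (THE B. \<exists>U d. unitary_mat (dim_row A) U \<and>
     A = U * mat_diag (dim_row A) (\<lambda>i. complex_of_real (d i)) * mat_adjoint U \<and>
     B = U * mat_diag (dim_row A) (\<lambda>i. complex_of_real (f (d i))) * mat_adjoint U)"

definition operator_convex :: "(real \<Rightarrow> real) \<Rightarrow> bool" where
  "operator_convex f \<longleftrightarrow>
     (\<forall>n N (X :: nat \<Rightarrow> complex mat) (c :: nat \<Rightarrow> real).
        (\<forall>k<N. psd n (X k)) \<longrightarrow> (\<forall>k<N. 0 \<le> c k) \<longrightarrow> (\<Sum>k<N. c k) = 1 \<longrightarrow>
        loewner_le n
          (fun_calc f (mat_sum n (\<lambda>k. complex_of_real (c k) \<cdot>\<^sub>m X k) {..<N}))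
          (mat_sum n (\<lambda>k. complex_of_real (c k) \<cdot>\<^sub>m fun_calc f (X k)) {..<N}))"

text \<open>
  \<open>D\<^sub>f\<^sup>m\<^sup>a\<^sup>x(\<rho>\<parallel>\<sigma>)\<close>, meaningful for invertible \<open>\<sigma>\<close>. The trace is that of a Hermitian
  matrix, hence real.
\<close>

definition max_f_divergence ::
    "(real \<Rightarrow> real) \<Rightarrow> complex mat \<Rightarrow> complex mat \<Rightarrow> real" where
  "max_f_divergence f \<rho> \<sigma> =
     (let S = fun_calc sqrt \<sigma>; T = fun_calc (\<lambda>x. 1 / sqrt x) \<sigma>
      in Re (trace_mat (S * fun_calc f (T * \<rho> * T) * S)))"

text \<open>
  An operator on \<open>\<complex>\<^sup>k \<otimes> \<complex>\<^sup>n\<close> is a \<open>kn \<times> kn\<close> matrix, the basis vector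
  \<open>e\<^sub>a \<otimes> e\<^sub>i\<close> having index \<open>a * n + i\<close>. It is thus a \<open>k \<times> k\<close> array of \<open>n \<times> n\<close> blocks,
  and \<open>id\<^sub>k \<otimes> W\<close> applies \<open>W\<close> to each block.
\<close>

definition block :: "nat \<Rightarrow> complex mat \<Rightarrow> nat \<Rightarrow> nat \<Rightarrow> complex mat" where
  "block n X a b = mat n n (\<lambda>(i, j). X $$ (a * n + i, b * n + j))"

definition ampliation ::
    "nat \<Rightarrow> nat \<Rightarrow> nat \<Rightarrow> (complex mat \<Rightarrow> complex mat) \<Rightarrow> complex mat \<Rightarrow> complex mat" where
  "ampliation k n m W X = mat (k * m) (k * m)
     (\<lambda>(i, j). W (block n X (i div m) (j div m)) $$ (i mod m, j mod m))"

definition linear_map_mat :: "nat \<Rightarrow> nat \<Rightarrow> (complex mat \<Rightarrow> complex mat) \<Rightarrow> bool" where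
  "linear_map_mat n m W \<longleftrightarrow>
     (\<forall>A \<in> carrier_mat n n. W A \<in> carrier_mat m m) \<and>
     (\<forall>A \<in> carrier_mat n n. \<forall>B \<in> carrier_mat n n. W (A + B) = W A + W B) \<and>
     (\<forall>c. \<forall>A \<in> carrier_mat n n. W (c \<cdot>\<^sub>m A) = c \<cdot>\<^sub>m W A)"

definition completely_positive :: "nat \<Rightarrow> nat \<Rightarrow> (complex mat \<Rightarrow> complex mat) \<Rightarrow> bool" where
  "completely_positive n m W \<longleftrightarrow>
     (\<forall>k X. psd (k * n) X \<longrightarrow> psd (k * m) (ampliation k n m W X))"

definition trace_preserving :: "nat \<Rightarrow> (complex mat \<Rightarrow> complex mat) \<Rightarrow> bool" where
  "trace_preserving n W \<longleftrightarrow> (\<forall>A \<in> carrier_mat n n. trace_mat (W A) = trace_mat A)"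

definition quantum_channel :: "nat \<Rightarrow> nat \<Rightarrow> (complex mat \<Rightarrow> complex mat) \<Rightarrow> bool" where
  "quantum_channel n m W \<longleftrightarrow>
     linear_map_mat n m W \<and> completely_positive n m W \<and> trace_preserving n W"

end

theory Submission
  imports Defs
begin

text \<open>
  Write \<open>P\<^sub>i = |u\<^sub>i\<rangle>\<langle>u\<^sub>i|\<close>, \<open>X = W(S)\<close> and \<open>T = X\<close> to the power \<open>-1/2\<close>. The operators
  \<open>M\<^sub>i = s\<^sub>i T W(P\<^sub>i) T\<close> are positive and sum to the identity, and \<open>T W(R) T = \<Sum>\<^sub>i \<lambda>\<^sub>i M\<^sub>i\<close>. Operator
  convexity gives the Jensen inequality \<open>f(\<Sum>\<^sub>i \<lambda>\<^sub>i M\<^sub>i) \<le> \<Sum>\<^sub>i f(\<lambda>\<^sub>i) M\<^sub>i\<close>, and conjugating it by the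
  square root of \<open>X\<close> and taking traces yields the bound \<open>\<Sum>\<^sub>i s\<^sub>i f(\<lambda>\<^sub>i)\<close>. Both \<open>D(R\<parallel>S)\<close> and
  \<open>D(\<rho>\<parallel>\<sigma>)\<close> are equal to this sum.
\<close>

subsection \<open>Adjoints and unitary matrices\<close>

text \<open>Operator convexity is given for scalar weights, whereas the \<open>M_i\<close> are
  operator weights that need not commute. The bridge is a dilation. Factors \<open>B_i\<close> with
  \<open>M_i = adj B_i * B_i\<close>, stacked into one tall matrix \<open>V\<close>, satisfy
  \<open>adj V * V = 1\<close>, and the weighted sum of the \<open>M_i\<close> becomes the
  compression \<open>adj V * D * V\<close> of a diagonal matrix \<open>D\<close> in which each
  eigenvalue is repeated. Completing the isometry \<open>V\<close> to a unitary makes this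
  compression a corner of a unitary conjugate of a padded \<open>D\<close>, and an average of just
  two matrices with weights 1/2 isolates that corner. The padding value never reaches it, because
  the \<open>M_i\<close> sum to exactly the identity.

  The weights \<open>s_i\<close> are the diagonal of \<sigma> in the eigenbasis of the normalised
  \<rho>. By cyclicity the divergence of \<rho> and \<sigma> is the trace of a matrix diagonal in
  that basis times \<sigma>, so it sees only this diagonal. This is why the general pair and the
  commuting pair have the same divergence.\<close>

abbreviation adj :: "complex mat \<Rightarrow> complex mat" where
  "adj \<equiv> mat_adjoint"

abbreviation rdiag :: "nat \<Rightarrow> (nat \<Rightarrow> real) \<Rightarrow> complex mat" where
  "rdiag n d \<equiv> mat_diag n (\<lambda>i. complex_of_real (d i))"

lemma dim_adj [simp]: "dim_row (adj A) = dim_col A" "dim_col (adj A) = dim_row A"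
  by (auto simp: mat_adjoint_def mat_of_rows_def)

lemma adj_carrier [simp]: "adj A \<in> carrier_mat n m \<longleftrightarrow> A \<in> carrier_mat m n"
  unfolding carrier_mat_def mem_Collect_eq dim_adj by (rule conj_commute)

lemma index_adj [simp]:
  assumes "i < dim_col A" "j < dim_row A"
  shows "adj A $$ (i, j) = cnj (A $$ (j, i))"
  using assms by (simp add: mat_adjoint_def mat_of_rows_index)

lemma dim_mat_diag [simp]: "dim_row (mat_diag n f) = n" "dim_col (mat_diag n f) = n"
  using mat_diag_dim[of n f] by (auto simp del: mat_diag_dim)

lemma index_mat_diag [simp]:
  "i < n \<Longrightarrow> j < n \<Longrightarrow> mat_diag n f $$ (i, j) = (if i = j then f j else 0)"
  by (simp add: mat_diag_def)

text \<open>Entries of products are computed with this rule while \<open>index_mult_mat(1)\<close>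
  is removed from the simpset, since the latter would produce scalar products of rows and columns
  instead of sums.\<close>

lemma index_mult_sum:
  "i < dim_row A \<Longrightarrow> j < dim_col B \<Longrightarrow> dim_col A = dim_row B \<Longrightarrow>
    (A * B) $$ (i, j) = (\<Sum>k<dim_row B. A $$ (i, k) * B $$ (k, j))"
  by (simp add: scalar_prod_def atLeast0LessThan)

lemma mat_mult_assoc:
  "dim_col A = dim_row B \<Longrightarrow> dim_col B = dim_row C \<Longrightarrow> (A * B) * C = A * (B * (C :: complex mat))"
  by (rule assoc_mult_mat[of _ "dim_row A" "dim_col A" _ "dim_col B" _ "dim_col C"]) auto

text \<open>Products are normalised to the right by \<open>mat_mult_assoc\<close>, so a pair such as
  \<open>adj U * U\<close> occurs with a tail \<open>C\<close> behind it. In this form the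
  simplifier can cancel the pair inside a chain.\<close>

lemma mat_mult_cancel:
  "A * B = 1\<^sub>m n \<Longrightarrow> dim_col A = dim_row B \<Longrightarrow> dim_col B = n \<Longrightarrow> dim_row C = n \<Longrightarrow>
    A * (B * (C :: complex mat)) = C"
  by (subst mat_mult_assoc[symmetric]) auto

lemma adj_adj [simp]: "adj (adj A) = A"
  by (rule eq_matI) auto

lemma adj_mult: "dim_col A = dim_row B \<Longrightarrow> adj (A * B) = adj B * adj A"
  by (rule eq_matI) (auto simp: index_mult_sum mult.commute simp del: index_mult_mat(1))

lemma adj_one [simp]: "adj (1\<^sub>m n) = 1\<^sub>m n"
  by (rule eq_matI) auto

lemma adj_rdiag [simp]: "adj (rdiag n d) = rdiag n d"
  by (rule eq_matI) auto

lemma adj_four_block: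
  assumes "A \<in> carrier_mat a c" "B \<in> carrier_mat a d" "C \<in> carrier_mat b c" "D \<in> carrier_mat b d"
  shows "adj (four_block_mat A B C D) = four_block_mat (adj A) (adj C) (adj B) (adj D)"
  using assms by (intro eq_matI) auto

lemma index_adj_mult:
  assumes "i < dim_col A" "j < dim_col B" "dim_row A = dim_row B"
  shows "(adj A * B) $$ (i, j) = col B j \<bullet>c col A i"
  using assms
  by (simp add: index_mult_sum scalar_prod_def atLeast0LessThan mult.commute del: index_mult_mat(1))

lemma index_adj_mult_self:
  assumes "i < dim_col G"
  shows "(adj G * G) $$ (i, i) = complex_of_real (\<Sum>k<dim_row G. (cmod (G $$ (k, i)))\<^sup>2)"
proof -
  have "(adj G * G) $$ (i, i) = (\<Sum>k<dim_row G. cnj (G $$ (k, i)) * G $$ (k, i))"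
    using assms by (simp add: index_mult_sum del: index_mult_mat(1))
  also have "\<dots> = (\<Sum>k<dim_row G. complex_of_real ((cmod (G $$ (k, i)))\<^sup>2))"
    by (intro sum.cong refl) (metis complex_norm_square mult.commute)
  finally show ?thesis
    by simp
qed

text \<open>Translates between quadratic forms of vectors, in which \<open>psd\<close> and the
  numbers \<open>s i\<close> are phrased, and entries of matrix products, in which all calculations
  are done.\<close>

lemma quadratic_form_index:
  assumes "A \<in> carrier_mat n n" "V \<in> carrier_mat n k" "i < k" "j < k"
  shows "(A *\<^sub>v col V i) \<bullet>c col V j = (adj V * A * V) $$ (j, i)"
proof -
  have "adj V * A * V = adj V * (A * V)"
    using assms by (intro mat_mult_assoc) auto
  moreover have "(adj V * (A * V)) $$ (j, i) = col (A * V) i \<bullet>c col V j"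
    using assms by (intro index_adj_mult) auto
  moreover have "col (A * V) i = A *\<^sub>v col V i"
    using assms by (intro col_mult2) auto
  ultimately show ?thesis
    by presburger
qed

lemma quadratic_form_vec:
  assumes "A \<in> carrier_mat n n" "v \<in> carrier_vec n"
  shows "(A *\<^sub>v v) \<bullet>c v = (adj (mat_of_cols n [v]) * A * mat_of_cols n [v]) $$ (0, 0)"
proof -
  have V: "mat_of_cols n [v] \<in> carrier_mat n 1"
    using mat_of_cols_carrier(1)[of n "[v]"] by simp
  have c: "col (mat_of_cols n [v]) 0 = v"
    using assms(2) by simp
  have "0 < (1 :: nat)"
    by simp
  from quadratic_form_index[OF assms(1) V this this, unfolded c] show ?thesis .
qed

lemma unitary_matD:
  assumes "unitary_mat n U"
  shows "U \<in> carrier_mat n n" "dim_row U = n" "dim_col U = n" "U * adj U = 1\<^sub>m n" "adj U * U = 1\<^sub>m n"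
  using assms unfolding unitary_mat_def by (blast dest: carrier_matD)+

text \<open>For square matrices a one-sided inverse is two-sided.\<close>

lemma unitary_matI:
  assumes "U \<in> carrier_mat n n" "adj U * U = 1\<^sub>m n"
  shows "unitary_mat n U"
proof -
  have "adj U \<in> carrier_mat n n"
    using assms(1) by simp
  from mat_mult_left_right_inverse[OF this assms] assms show ?thesis
    by (simp only: unitary_mat_def simp_thms)
qed

lemma unitary_mat_mult:
  assumes "unitary_mat n U" "unitary_mat n V"
  shows "unitary_mat n (U * V)"
proof (rule unitary_matI)
  note U = unitary_matD[OF assms(1)] and V = unitary_matD[OF assms(2)]
  show "U * V \<in> carrier_mat n n"
    using U(1) V(1) by simp
  show "adj (U * V) * (U * V) = 1\<^sub>m n"
    using U(2,3) V(2,3)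
    by (simp add: adj_mult mat_mult_assoc mat_mult_cancel[OF U(5)] V(5))
qed

lemma unitary_mat_four_block:
  assumes "unitary_mat m U" "unitary_mat k V"
  shows "unitary_mat (m + k) (four_block_mat U (0\<^sub>m m k) (0\<^sub>m k m) V)"
proof (rule unitary_matI)
  note U = unitary_matD[OF assms(1)] and V = unitary_matD[OF assms(2)]
  have z: "adj (0\<^sub>m m k) = 0\<^sub>m k m" "adj (0\<^sub>m k m) = 0\<^sub>m m k"
    by (rule eq_matI; simp)+
  show "adj (four_block_mat U (0\<^sub>m m k) (0\<^sub>m k m) V) * four_block_mat U (0\<^sub>m m k) (0\<^sub>m k m) V
      = 1\<^sub>m (m + k)"
    using U(1) V(1)
    by (simp add: adj_four_block[of _ m m _ k _ k] z U(5) V(5)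
        mult_four_block_mat[of _ m m _ k _ k _ _ m _ k] four_block_one_mat)
qed (use assms in \<open>auto simp: unitary_mat_def\<close>)

text \<open>The deflation step of the spectral theorem: an eigenvector is extended to a basis, which
  Gram-Schmidt makes orthogonal without changing its first vector. The scalar \<open>a\<close>
  absorbs the normalisation.\<close>

lemma unitary_with_first_column:
  assumes v: "v \<in> carrier_vec n" and v0: "v \<noteq> 0\<^sub>v n"
  shows "\<exists>U a. unitary_mat n U \<and> col U 0 = a \<cdot>\<^sub>v v"
proof -
  interpret cof_vec_space n "TYPE(complex)" .
  define ws where "ws = gram_schmidt n (basis_completion v)"
  note bc = basis_completion[OF v v0]
  have n: "0 < n"
    using v v0 by (cases n) auto
  then obtain vs where bv: "basis_completion v = v # vs"
    using bc(6,7) by (cases "basis_completion v") auto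
  have ws: "set ws \<subseteq> carrier_vec n" "corthogonal ws" "length ws = n"
    using gram_schmidt_result[OF bc(2,4,5) refl] bc(6) by (auto simp: ws_def)
  have hd: "ws ! 0 = v"
    using gram_schmidt_hd[OF v, of vs] ws(3) n by (metis bv hd_conv_nth length_greater_0_conv ws_def)
  have wsi: "ws ! i \<in> carrier_vec n" if "i < n" for i
    using ws that by (auto simp: subset_iff)
  \<comment> \<open>Gram-Schmidt is used here only for orthogonality; the factors \<open>c i\<close>
    scale the columns to unit length.\<close>
  define c where "c i = 1 / sqrt (Re (ws ! i \<bullet>c ws ! i))" for i
  define U where "U = mat_of_cols n ws * rdiag n c"
  have W: "mat_of_cols n ws \<in> carrier_mat n n"
    using ws by auto
  have U: "U \<in> carrier_mat n n"
    using W by (auto simp: U_def)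
  have colU: "col U i = complex_of_real (c i) \<cdot>\<^sub>v ws ! i" if "i < n" for i
    using that ws(3) wsi[OF that] W
    by (intro eq_vecI) (auto simp: U_def mat_diag_mult_right[of _ n] mat_of_cols_index mult.commute)
  have "(adj U * U) $$ (i, j) = 1\<^sub>m n $$ (i, j)" if ij: "i < n" "j < n" for i j
  proof -
    have *: "(adj U * U) $$ (i, j) = complex_of_real (c i * c j) * (ws ! j \<bullet>c ws ! i)"
      using ij U wsi
      by (simp add: index_adj_mult colU conjugate_smult_vec smult_scalar_prod_distrib[of _ n]
          scalar_prod_smult_distrib[of _ n] del: index_mult_mat(1))
    show ?thesis
    proof (cases "i = j")
      case False
      then show ?thesis
        using * corthogonalD[OF ws(2), of j i] ij ws(3) by simp
    next
      case True
      have "ws ! i \<bullet>c ws ! i > 0"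
        using corthogonalD[OF ws(2), of i i] ij ws(3) conjugate_square_greater_0_vec[OF wsi, of i]
        by (metis conjugate_square_eq_0_vec wsi)
      then have "Re (ws ! i \<bullet>c ws ! i) > 0" "ws ! i \<bullet>c ws ! i = of_real (Re (ws ! i \<bullet>c ws ! i))"
        by (auto simp: less_complex_def complex_eq_iff)
      moreover have "c i * c i * x = 1" if "x > 0" "x = Re (ws ! i \<bullet>c ws ! i)" for x
        using that by (simp add: c_def)
      ultimately show ?thesis
        using * True ij by (metis index_one_mat(1) of_real_1 of_real_mult)
    qed
  qed
  then have "adj U * U = 1\<^sub>m n"
    using U by (intro eq_matI) auto
  then show ?thesis
    using unitary_matI[OF U] colU[OF n] hd by auto
qed

subsection \<open>Spectral theorem, functional calculus and positivity\<close>

lemma mat_diag_cong: "(\<And>i. i < n \<Longrightarrow> f i = g i) \<Longrightarrow> mat_diag n f = mat_diag n g"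
  by (rule eq_matI) auto

lemma unitary_conj_eqD:
  assumes "unitary_mat n W" "A \<in> carrier_mat n n" "adj W * A * W = B"
  shows "A = W * B * adj W"
proof -
  note W = unitary_matD[OF assms(1)]
  have "W * B * adj W = A * (W * adj W)"
    unfolding assms(3)[symmetric] using W(2,3) assms(2)
    by (simp add: mat_mult_assoc mat_mult_cancel[OF W(4)])
  then show ?thesis
    using W(4) assms(2) by simp
qed

lemma four_block_unitary_diag:
  assumes "U \<in> carrier_mat m m" "V \<in> carrier_mat k k"
  shows "four_block_mat U (0\<^sub>m m k) (0\<^sub>m k m) V * rdiag (m + k) (\<lambda>i. if i < m then d i else e (i - m))
      * adj (four_block_mat U (0\<^sub>m m k) (0\<^sub>m k m) V) =
    four_block_mat (U * rdiag m d * adj U) (0\<^sub>m m k) (0\<^sub>m k m) (V * rdiag k e * adj V)"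
proof -
  have D: "rdiag (m + k) (\<lambda>i. if i < m then d i else e (i - m)) =
      four_block_mat (rdiag m d) (0\<^sub>m m k) (0\<^sub>m k m) (rdiag k e)"
    by (rule eq_matI) auto
  have z: "adj (0\<^sub>m m k) = 0\<^sub>m k m" "adj (0\<^sub>m k m) = 0\<^sub>m m k"
    by (rule eq_matI; simp)+
  have "U * rdiag m d \<in> carrier_mat m m" "V * rdiag k e \<in> carrier_mat k k"
    "U * rdiag m d * adj U \<in> carrier_mat m m" "V * rdiag k e * adj V \<in> carrier_mat k k"
    using assms by auto
  then show ?thesis
    unfolding D using assms
    by (simp add: adj_four_block[of _ m m _ k _ k] z
        mult_four_block_mat[of _ m m _ k _ k _ _ m _ k]
        left_add_zero_mat[of _ k k] right_add_zero_mat[of _ m m])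
qed

text \<open>Deflation: the characteristic polynomial splits over the complex numbers, so an
  eigenvector exists and can be made the first column of a unitary \<open>W\<close>. In that basis
  the first column of the matrix vanishes below the diagonal, hence by symmetry so does the rest of
  the first row, and the induction hypothesis applies to the remaining block.\<close>

theorem hermitian_diagonalizable:
  assumes "A \<in> carrier_mat n n" "hermitian_mat A"
  shows "\<exists>U d. unitary_mat n U \<and> A = U * rdiag n d * adj U"
  using assms
proof (induction n arbitrary: A)
  case 0
  then have "unitary_mat 0 (1\<^sub>m 0) \<and> A = 1\<^sub>m 0 * rdiag 0 (\<lambda>_. 0) * adj (1\<^sub>m 0)"
    by (auto simp: unitary_mat_def)
  then show ?case
    by (intro exI)
next
  case (Suc n A)
  note A = Suc.prems(1)
  have adjA: "adj A = A"
    using Suc.prems(2) by (simp add: hermitian_mat_def)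
  obtain es where es: "char_poly A = (\<Prod>a\<leftarrow>es. [:- a, 1:])" "length es = Suc n"
    using char_poly_factorized[OF A] by blast
  then obtain e es' where "es = e # es'"
    by (cases es) auto
  then have "eigenvalue A e"
    using es(1) eigenvalue_root_char_poly[OF A] by simp
  then obtain v where v: "v \<in> carrier_vec (Suc n)" "v \<noteq> 0\<^sub>v (Suc n)" "A *\<^sub>v v = e \<cdot>\<^sub>v v"
    using A by (auto simp: eigenvalue_def eigenvector_def)
  obtain W a where W: "unitary_mat (Suc n) W" and W0: "col W 0 = a \<cdot>\<^sub>v v"
    using unitary_with_first_column[OF v(1,2)] by blast
  note WD = unitary_matD[OF W]
  define B where "B = adj W * A * W"
  have B: "B \<in> carrier_mat (Suc n) (Suc n)"
    using A WD by (simp add: B_def)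
  have adjB: "adj B = B"
    unfolding B_def using A WD(2,3) by (simp add: adj_mult mat_mult_assoc adjA)
  have sym: "cnj (B $$ (j, i)) = B $$ (i, j)" if "i < Suc n" "j < Suc n" for i j
    using that B index_adj[of i B j] adjB by auto
  have B0: "B $$ (i, 0) = (if i = 0 then e else 0)" if i: "i < Suc n" for i
  proof -
    have "B = adj W * (A * W)"
      unfolding B_def using A WD(2,3) by (simp add: mat_mult_assoc)
    then have "B $$ (i, 0) = col (A * W) 0 \<bullet>c col W i"
      using i A WD(2,3) by (simp add: index_adj_mult del: index_mult_mat(1))
    also have "col (A * W) 0 = A *\<^sub>v col W 0"
      using A WD(1) by (intro col_mult2) auto
    also have "\<dots> = e \<cdot>\<^sub>v col W 0"
      using A v by (auto simp: W0 mult_mat_vec smult_smult_assoc mult.commute)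
    also have "(e \<cdot>\<^sub>v col W 0) \<bullet>c col W i = e * (col W 0 \<bullet>c col W i)"
      using i WD(2) by (intro smult_scalar_prod_distrib[of _ "Suc n"] carrier_vecI) simp_all
    also have "col W 0 \<bullet>c col W i = (adj W * W) $$ (i, 0)"
      using i WD(2,3) by (simp add: index_adj_mult del: index_mult_mat(1))
    finally show ?thesis
      using i WD(5) by simp
  qed
  \<comment> \<open>A diagonal entry of a Hermitian matrix equals its own conjugate, so the
    eigenvalue is real.\<close>
  have e: "e = complex_of_real (Re e)"
    using sym[of 0 0] B0[of 0] by (auto simp: complex_eq_iff)
  have B0': "B $$ (0, j) = (if j = 0 then e else 0)" if "j < Suc n" for j
    using that B0[OF that] sym[of 0 j] by (auto split: if_splits)
  define C where "C = mat n n (\<lambda>(i, j). B $$ (Suc i, Suc j))"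
  have C: "C \<in> carrier_mat n n"
    by (simp add: C_def)
  have "hermitian_mat C"
    unfolding hermitian_mat_def by (rule eq_matI) (auto simp: C_def sym)
  from Suc.IH[OF C this] obtain U d where U: "unitary_mat n U" and CU: "C = U * rdiag n d * adj U"
    by blast
  define Q where "Q = four_block_mat (1\<^sub>m 1) (0\<^sub>m 1 n) (0\<^sub>m n 1) U"
  \<comment> \<open>The eigenvalue split off takes index 0, which shifts the eigenvalues of
    \<open>C\<close> by one.\<close>
  define D where "D = rdiag (Suc n) (\<lambda>i. if i < 1 then Re e else d (i - 1))"
  have "unitary_mat 1 (1\<^sub>m 1)"
    by (simp add: unitary_mat_def)
  from unitary_mat_four_block[OF this U] have Q: "unitary_mat (Suc n) Q"
    by (simp add: Q_def)
  note QD = unitary_matD[OF Q]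
  have "B = four_block_mat (1\<^sub>m 1 * rdiag 1 (\<lambda>_. Re e) * adj (1\<^sub>m 1)) (0\<^sub>m 1 n) (0\<^sub>m n 1) C"
    using B C e by (intro eq_matI) (auto simp: B0 B0' C_def)
  also have "\<dots> = Q * D * adj Q"
    using four_block_unitary_diag[of "1\<^sub>m 1" 1 U n "\<lambda>_. Re e" d] unitary_matD(1)[OF U]
    by (simp add: Q_def D_def CU)
  finally have "A = W * (Q * D * adj Q) * adj W"
    using unitary_conj_eqD[OF W A B_def[symmetric]] by simp
  also have "\<dots> = (W * Q) * D * adj (W * Q)"
    using WD(2,3) QD(2,3) by (simp add: adj_mult mat_mult_assoc D_def)
  finally show ?case
    unfolding D_def using unitary_mat_mult[OF W Q]
    by (intro exI[of _ "W * Q"] exI[of _ "\<lambda>i. if i < 1 then Re e else d (i - 1)"] conjI)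
qed

text \<open>This makes the definite description in \<open>fun_calc\<close> meaningful: any two
  diagonalisations of one matrix lead to the same result. The matrix \<open>W = adj V * U\<close>
  intertwines the two diagonal matrices, and this relation survives the application of
  \<open>f\<close> to both.\<close>

lemma fun_calc_unitary_diag:
  assumes U: "unitary_mat n U"
  shows "fun_calc f (U * rdiag n d * adj U) = U * rdiag n (\<lambda>i. f (d i)) * adj U"
proof -
  note UD = unitary_matD[OF U]
  have unique: "V * rdiag n (\<lambda>i. f (e i)) * adj V = U * rdiag n (\<lambda>i. f (d i)) * adj U"
    if V: "unitary_mat n V" and eq: "U * rdiag n d * adj U = V * rdiag n e * adj V" for V e
  proof -
    note VD = unitary_matD[OF V]
    define W where "W = adj V * U"
    have W: "W \<in> carrier_mat n n"
      using UD VD by (simp add: W_def)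
    have VW: "V * W = U" and WU: "W * adj U = adj V"
      using UD(2,3) VD(2,3) by (simp_all add: W_def mat_mult_cancel[OF VD(4)] mat_mult_assoc UD(4))
    have "adj V * (U * rdiag n d * adj U) * U = adj V * (V * rdiag n e * adj V) * U"
      by (simp only: eq)
    then have "W * rdiag n d = rdiag n e * W"
      using UD(2,3) VD(2,3)
      by (simp add: W_def mat_mult_assoc mat_mult_cancel[OF VD(5)] UD(5))
    then have "W $$ (i, j) * complex_of_real (d j) = complex_of_real (e i) * W $$ (i, j)"
      if "i < n" "j < n" for i j
      using that by (simp add: mat_diag_mult_right[OF W] mat_diag_mult_left[OF W] mat_eq_iff)
    \<comment> \<open>Either the entry of \<open>W\<close> vanishes or \<open>d j = e i\<close>; in
      both cases \<open>f\<close> may be applied to the eigenvalues.\<close>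
    then have "W $$ (i, j) * complex_of_real (f (d j)) = complex_of_real (f (e i)) * W $$ (i, j)"
      if "i < n" "j < n" for i j
      using that by (cases "W $$ (i, j) = 0") (fastforce simp: mult.commute)+
    then have comm: "W * rdiag n (\<lambda>i. f (d i)) = rdiag n (\<lambda>i. f (e i)) * W"
      by (auto simp: mat_diag_mult_right[OF W] mat_diag_mult_left[OF W])
    have "V * rdiag n (\<lambda>i. f (e i)) * adj V = V * (rdiag n (\<lambda>i. f (e i)) * W) * adj U"
      using UD(2,3) VD(2,3) W by (simp add: mat_mult_assoc WU)
    also have "\<dots> = (V * W) * rdiag n (\<lambda>i. f (d i)) * adj U"
      using UD(2,3) VD(2,3) W by (simp add: mat_mult_assoc comm[symmetric])
    finally show ?thesis
      by (simp only: VW)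
  qed
  have dim: "dim_row (U * rdiag n d * adj U) = n"
    using UD(2) by simp
  show ?thesis
    unfolding fun_calc_def dim
  proof (rule the_equality)
    show "\<exists>V e. unitary_mat n V \<and> U * rdiag n d * adj U = V * rdiag n e * adj V \<and>
        U * rdiag n (\<lambda>i. f (d i)) * adj U = V * rdiag n (\<lambda>i. f (e i)) * adj V"
      by (intro exI[of _ U] exI[of _ d] conjI U refl)
  qed (elim exE conjE, simp only: unique)
qed

section \<open>Positive semidefinite matrices as Gram matrices\<close>

lemma psd_adj_mult:
  assumes "B \<in> carrier_mat k n"
  shows "psd n (adj B * B)"
  unfolding psd_def
proof (intro conjI ballI)
  show BB: "adj B * B \<in> carrier_mat n n"
    using assms by simp
  show "hermitian_mat (adj B * B)"
    by (simp add: hermitian_mat_def adj_mult)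
  fix v :: "complex vec" assume v: "v \<in> carrier_vec n"
  let ?V = "mat_of_cols n [v]"
  have "adj ?V * (adj B * B) * ?V = adj (B * ?V) * (B * ?V)"
    using assms by (simp add: adj_mult mat_mult_assoc)
  then have "((adj B * B) *\<^sub>v v) \<bullet>c v = (adj (B * ?V) * (B * ?V)) $$ (0, 0)"
    using quadratic_form_vec[OF BB v] by simp
  also have "\<dots> = complex_of_real (\<Sum>k<dim_row (B * ?V). (cmod ((B * ?V) $$ (k, 0)))\<^sup>2)"
    by (rule index_adj_mult_self) simp
  finally show "0 \<le> Re (((adj B * B) *\<^sub>v v) \<bullet>c v)"
    by (simp add: sum_nonneg)
qed

lemma psd_diagonalizable:
  assumes "psd n A"
  obtains U d where "unitary_mat n U" "\<And>i. i < n \<Longrightarrow> 0 \<le> d i" "A = U * rdiag n d * adj U"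
proof -
  have A: "A \<in> carrier_mat n n" "hermitian_mat A"
    using assms by (auto simp: psd_def)
  obtain U d where U: "unitary_mat n U" and AU: "A = U * rdiag n d * adj U"
    using hermitian_diagonalizable[OF A] by blast
  note UD = unitary_matD[OF U]
  have "0 \<le> d i" if i: "i < n" for i
  proof -
    have "adj U * A * U = rdiag n d"
      using UD(2,3) by (simp add: AU mat_mult_assoc mat_mult_cancel[OF UD(5)] UD(5) right_mult_one_mat[of _ n])
    then have "(A *\<^sub>v col U i) \<bullet>c col U i = complex_of_real (d i)"
      using quadratic_form_index[OF A(1) UD(1) i i] i by simp
    moreover have "0 \<le> Re ((A *\<^sub>v col U i) \<bullet>c col U i)"
      using assms UD(2) col_carrier_vec[of i n U] i UD(1) by (auto simp: psd_def)
    ultimately show ?thesis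
      by simp
  qed
  with U AU that show ?thesis
    by blast
qed

text \<open>The square roots of the eigenvalues give the factor. Together with
  \<open>psd_adj_mult\<close> this reduces closure properties of positivity to exhibiting a new
  factor.\<close>

lemma psd_factor:
  assumes "psd n A"
  obtains B where "B \<in> carrier_mat n n" "A = adj B * B"
proof -
  obtain U d where U: "unitary_mat n U" and d: "\<And>i. i < n \<Longrightarrow> 0 \<le> d i"
    and A: "A = U * rdiag n d * adj U"
    using psd_diagonalizable[OF assms] by metis
  note UD = unitary_matD[OF U]
  let ?B = "rdiag n (\<lambda>i. sqrt (d i)) * adj U"
  have "rdiag n (\<lambda>i. sqrt (d i)) * rdiag n (\<lambda>i. sqrt (d i)) = rdiag n d"
    using d by (auto intro!: mat_diag_cong simp flip: of_real_mult)
  then have "adj ?B * ?B = A"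
    using UD(2,3)
    by (simp add: adj_mult mat_mult_assoc A del: mat_diag_diag)
       (simp add: mat_mult_assoc[symmetric] del: mat_diag_diag)
  moreover have "?B \<in> carrier_mat n n"
    using UD(1) by (intro mult_carrier_mat[of _ n n]) simp_all
  ultimately show ?thesis
    using that by blast
qed

lemma psd_congruence:
  assumes "psd n A" "C \<in> carrier_mat n k"
  shows "psd k (adj C * A * C)"
proof -
  obtain B where B: "B \<in> carrier_mat n n" "A = adj B * B"
    using psd_factor[OF assms(1)] by blast
  then have "adj C * A * C = adj (B * C) * (B * C)"
    using assms(2) by (simp add: adj_mult mat_mult_assoc)
  then show ?thesis
    using psd_adj_mult[of "B * C" n k] B(1) assms(2) by simp
qed

lemma psd_trace:
  assumes "psd n A"
  shows "0 \<le> Re (trace_mat A)"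
proof -
  obtain B where B: "B \<in> carrier_mat n n" "A = adj B * B"
    using psd_factor[OF assms] by blast
  have "trace_mat A = (\<Sum>i<n. complex_of_real (\<Sum>k<n. (cmod (B $$ (k, i)))\<^sup>2))"
    unfolding trace_mat_def using B
    by (intro sum.cong) (auto simp: index_adj_mult_self simp del: index_mult_mat(1))
  then show ?thesis
    by (simp add: sum_nonneg)
qed

text \<open>If the whole matrix is the Gram matrix of the columns of \<open>G\<close>, its corner is
  the Gram matrix of the first \<open>m\<close> of them.\<close>

lemma psd_upper_left:
  assumes "psd (m + k) (four_block_mat A B C D)" "A \<in> carrier_mat m m" "D \<in> carrier_mat k k"
  shows "psd m A"
proof -
  obtain G where G: "G \<in> carrier_mat (m + k) (m + k)" "four_block_mat A B C D = adj G * G"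
    using psd_factor[OF assms(1)] by blast
  define H where "H = mat (m + k) m (\<lambda>(i, j). G $$ (i, j))"
  have "A = adj H * H"
  proof (rule eq_matI)
    fix i j assume "i < dim_row (adj H * H)" "j < dim_col (adj H * H)"
    then have ij: "i < m" "j < m"
      by (auto simp: H_def)
    have "A $$ (i, j) = (adj G * G) $$ (i, j)"
      using ij assms(2,3) G(2)[symmetric] by simp
    then show "A $$ (i, j) = (adj H * H) $$ (i, j)"
      using ij G(1) by (simp add: index_mult_sum H_def del: index_mult_mat(1))
  qed (use assms(2) in \<open>auto simp: H_def\<close>)
  then show ?thesis
    using psd_adj_mult[of H "m + k" m] by (simp add: H_def)
qed

subsection \<open>Operator Jensen inequality\<close>

lemma mult3_carrier:
  "A \<in> carrier_mat a b \<Longrightarrow> B \<in> carrier_mat b c \<Longrightarrow> C \<in> carrier_mat c d \<Longrightarrow>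
    A * B * C \<in> carrier_mat a d"
  by auto

lemma psd_carrier: "psd n A \<Longrightarrow> A \<in> carrier_mat n n"
  by (simp add: psd_def)

lemma psd_hermitian: "psd n A \<Longrightarrow> hermitian_mat A"
  by (simp add: psd_def)

lemma unitary_diag_carrier: "unitary_mat n U \<Longrightarrow> U * rdiag n d * adj U \<in> carrier_mat n n"
  by (intro mult3_carrier[of _ n n _ n]) (simp_all add: unitary_matD(1))

lemma fun_calc_carrier:
  assumes "A \<in> carrier_mat n n" "hermitian_mat A"
  shows "fun_calc f A \<in> carrier_mat n n"
proof -
  obtain U d where "unitary_mat n U" "A = U * rdiag n d * adj U"
    using hermitian_diagonalizable[OF assms] by blast
  then show ?thesis
    by (simp only: fun_calc_unitary_diag unitary_diag_carrier)
qed

lemma fun_calc_unitary_conj: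
  assumes "A \<in> carrier_mat n n" "hermitian_mat A" "unitary_mat n W"
  shows "fun_calc f (W * A * adj W) = W * fun_calc f A * adj W"
proof -
  obtain U d where U: "unitary_mat n U" "A = U * rdiag n d * adj U"
    using hermitian_diagonalizable[OF assms(1,2)] by blast
  note UD = unitary_matD[OF U(1)] and WD = unitary_matD[OF assms(3)]
  have *: "W * (U * rdiag n g * adj U) * adj W = (W * U) * rdiag n g * adj (W * U)" for g
    using UD(2,3) WD(2,3) by (simp add: adj_mult mat_mult_assoc)
  show ?thesis
    unfolding U(2) fun_calc_unitary_diag[OF U(1)] *
    by (rule fun_calc_unitary_diag[OF unitary_mat_mult[OF assms(3) U(1)]])
qed

lemma fun_calc_four_block:
  assumes "A \<in> carrier_mat m m" "hermitian_mat A" "D \<in> carrier_mat k k" "hermitian_mat D"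
  shows "fun_calc f (four_block_mat A (0\<^sub>m m k) (0\<^sub>m k m) D) =
    four_block_mat (fun_calc f A) (0\<^sub>m m k) (0\<^sub>m k m) (fun_calc f D)"
proof -
  obtain U d where U: "unitary_mat m U" "A = U * rdiag m d * adj U"
    using hermitian_diagonalizable[OF assms(1,2)] by blast
  obtain V e where V: "unitary_mat k V" "D = V * rdiag k e * adj V"
    using hermitian_diagonalizable[OF assms(3,4)] by blast
  note UV = unitary_mat_four_block[OF U(1) V(1)]
  note block = four_block_unitary_diag[OF unitary_matD(1)[OF U(1)] unitary_matD(1)[OF V(1)]]
  have if_f: "f (if i < m then d i else e (i - m)) = (if i < m then f (d i) else f (e (i - m)))" for i
    by simp
  show ?thesis
    unfolding U(2) V(2) fun_calc_unitary_diag[OF U(1)] fun_calc_unitary_diag[OF V(1)]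
      block[symmetric] fun_calc_unitary_diag[OF UV] if_f ..
qed

text \<open>
  Averaging \<open>A\<close> with its conjugate by \<open>diag(1, -1)\<close> removes the off-diagonal blocks.
\<close>

lemma operator_convex_pinching:
  assumes f: "operator_convex f" and A: "psd (m + k) A"
    and AB: "A = four_block_mat A1 A2 A3 A4"
    and FB: "fun_calc f A = four_block_mat F1 F2 F3 F4"
    and A1: "A1 \<in> carrier_mat m m" and A4: "A4 \<in> carrier_mat k k"
    and F1: "F1 \<in> carrier_mat m m" and F4: "F4 \<in> carrier_mat k k"
  shows "loewner_le m (fun_calc f A1) F1"
proof -
  define J where "J = rdiag (m + k) (\<lambda>i. if i < m then 1 else - 1)"
  have J: "J \<in> carrier_mat (m + k) (m + k)" and adjJ: "adj J = J"
    by (simp_all add: J_def)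
  have "J * J = 1\<^sub>m (m + k)"
    by (rule eq_matI) (auto simp: J_def)
  then have UJ: "unitary_mat (m + k) J"
    using J by (simp add: unitary_mat_def adjJ)
  have A4H: "hermitian_mat A4"
    unfolding hermitian_mat_def
  proof (rule eq_matI)
    fix i j assume "i < dim_row A4" "j < dim_col A4"
    then have ij: "i < k" "j < k"
      using A4 by auto
    have "adj A $$ (m + i, m + j) = A $$ (m + i, m + j)"
      using psd_hermitian[OF A] by (simp add: hermitian_mat_def)
    then show "adj A4 $$ (i, j) = A4 $$ (i, j)"
      using ij A1 A4 by (simp add: AB)
  qed (use A4 in auto)
  have A1P: "psd m A1"
    using psd_upper_left[of m k A1 A2 A3 A4] A A1 A4 by (simp add: AB)
  \<comment> \<open>Stated for an arbitrary block matrix \<open>G\<close>, because the same average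
    is taken of \<open>A\<close> and of \<open>fun_calc f A\<close>.\<close>
  have half: "mat_sum (m + k) (\<lambda>l. complex_of_real (1/2) \<cdot>\<^sub>m (if l = 0 then G else J * G * J)) {..<2 :: nat} =
      four_block_mat G1 (0\<^sub>m m k) (0\<^sub>m k m) G4"
    if G: "G = four_block_mat G1 G2 G3 G4" "G1 \<in> carrier_mat m m" "G4 \<in> carrier_mat k k"
    for G G1 G2 G3 G4
  proof -
    have GC: "G \<in> carrier_mat (m + k) (m + k)"
      using G by auto
    have "J * G * J = mat (m + k) (m + k)
        (\<lambda>(i, j). (if i < m then 1 else - 1) * G $$ (i, j) * (if j < m then 1 else - 1))"
      using GC by (auto simp: J_def mat_diag_mult_left[of _ _ "m + k"] mat_diag_mult_right[of _ "m + k"])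
    then show ?thesis
      using G GC by (intro eq_matI) (auto simp: mat_sum_def numeral_2_eq_2 lessThan_Suc)
  qed
  let ?X = "\<lambda>l :: nat. if l = 0 then A else J * A * J"
  have psdX: "psd (m + k) (?X l)" for l
    using A psd_congruence[OF A J] by (simp add: adjJ)
  have fX: "fun_calc f (?X l) = (if l = 0 then fun_calc f A else J * fun_calc f A * J)" for l
    using fun_calc_unitary_conj[OF psd_carrier[OF A] psd_hermitian[OF A] UJ] by (simp add: adjJ)
  have "loewner_le (m + k)
      (fun_calc f (mat_sum (m + k) (\<lambda>l. complex_of_real (1/2) \<cdot>\<^sub>m ?X l) {..<2}))
      (mat_sum (m + k) (\<lambda>l. complex_of_real (1/2) \<cdot>\<^sub>m fun_calc f (?X l)) {..<2})"
    using f[unfolded operator_convex_def, rule_format, of 2 "m + k" ?X "\<lambda>_. 1/2"] psdX by simp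
  then have le: "loewner_le (m + k)
      (four_block_mat (fun_calc f A1) (0\<^sub>m m k) (0\<^sub>m k m) (fun_calc f A4))
      (four_block_mat F1 (0\<^sub>m m k) (0\<^sub>m k m) F4)"
    unfolding fX half[OF AB A1 A4] half[OF FB F1 F4]
      fun_calc_four_block[OF A1 psd_hermitian[OF A1P] A4 A4H] .
  note fA1 = fun_calc_carrier[OF A1 psd_hermitian[OF A1P], of f]
    and fA4 = fun_calc_carrier[OF A4 A4H, of f]
  have "four_block_mat F1 (0\<^sub>m m k) (0\<^sub>m k m) F4
      - four_block_mat (fun_calc f A1) (0\<^sub>m m k) (0\<^sub>m k m) (fun_calc f A4)
    = four_block_mat (F1 - fun_calc f A1) (0\<^sub>m m k) (0\<^sub>m k m) (F4 - fun_calc f A4)"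
    using fA1 fA4 F1 F4 by (intro eq_matI) auto
  with le have "psd (m + k) (four_block_mat (F1 - fun_calc f A1) (0\<^sub>m m k) (0\<^sub>m k m) (F4 - fun_calc f A4))"
    by (simp add: loewner_le_def)
  then have "psd m (F1 - fun_calc f A1)"
    by (rule psd_upper_left) (use fA1 fA4 in \<open>auto intro!: minus_carrier_mat\<close>)
  then show ?thesis
    using fA1 F1 by (simp add: loewner_le_def)
qed

text \<open>
  Hansen--Pedersen: the isometry \<open>V\<close> is dilated to the unitary \<open>[V, 1 - V V\<^sup>*; 0, -V\<^sup>*]\<close>.
\<close>

lemma operator_jensen_isometry:
  assumes f: "operator_convex f" and V: "V \<in> carrier_mat k m" and VV: "adj V * V = 1\<^sub>m m"
    and d: "\<And>i. i < k \<Longrightarrow> 0 \<le> d i"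
  shows "loewner_le m (fun_calc f (adj V * rdiag k d * V)) (adj V * rdiag k (\<lambda>i. f (d i)) * V)"
proof -
  \<comment> \<open>The projection onto the orthogonal complement of the range of \<open>V\<close>.
    It supplies the directions that \<open>V\<close> misses: the facts \<open>P * V = 0\<close> and
    \<open>P * P + V * adj V = 1\<close> are what unitarity of \<open>Q\<close> demands of the
    blocks containing \<open>P\<close>.\<close>
  define P where "P = 1\<^sub>m k - V * adj V"
  have P: "P \<in> carrier_mat k k"
    using V by (auto simp: P_def intro!: minus_carrier_mat)
  have adjP: "adj P = P"
  proof -
    have "hermitian_mat (V * adj V)"
      by (simp add: hermitian_mat_def adj_mult)
    then have "cnj ((V * adj V) $$ (j, i)) = (V * adj V) $$ (i, j)" if "i < k" "j < k" for i j
      using index_adj[of i "V * adj V" j] that V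
      by (simp add: hermitian_mat_def del: index_mult_mat(1))
    then show ?thesis
      using V by (intro eq_matI) (auto simp: P_def simp del: index_mult_mat(1))
  qed
  have PV: "P * V = 0\<^sub>m k m"
  proof -
    have "P * V = 1\<^sub>m k * V - V * adj V * V"
      unfolding P_def using V by (intro minus_mult_distrib_mat[of _ k k _ _ m]) auto
    also have "V * adj V * V = V"
      using V by (simp add: mat_mult_assoc VV)
    finally show ?thesis
      using V by simp
  qed
  have VP: "adj V * P = 0\<^sub>m m k"
  proof -
    have "adj V * P = adj (P * V)"
      using V P by (simp add: adj_mult adjP)
    also have "\<dots> = 0\<^sub>m m k"
      unfolding PV by (rule eq_matI) auto
    finally show ?thesis .
  qed
  have PP: "P * P + V * adj V = 1\<^sub>m k"
  proof -
    have "P * P = P * 1\<^sub>m k - P * (V * adj V)"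
      unfolding P_def using V P[unfolded P_def] by (intro mult_minus_distrib_mat[of _ k k _ k]) auto
    also have "P * (V * adj V) = 0\<^sub>m k k"
      using V P by (subst mat_mult_assoc[symmetric]) (auto simp: PV)
    finally have "P * P = P"
      using P by auto
    then show ?thesis
      using V by (intro eq_matI) (auto simp: P_def)
  qed
  define Q where "Q = four_block_mat V P (0\<^sub>m m m) (- adj V)"
  have adjQ: "adj Q = four_block_mat (adj V) (0\<^sub>m m m) P (- V)"
  proof -
    have "adj (- adj V) = - V" "adj (0\<^sub>m m m) = 0\<^sub>m m m"
      by (rule eq_matI; simp)+
    then show ?thesis
      using V P by (simp add: Q_def adj_four_block[of _ k m _ k _ m] adjP)
  qed
  have Q: "Q \<in> carrier_mat (m + k) (m + k)"
    using V P by (auto simp: Q_def)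
  have "adj Q * Q = four_block_mat (1\<^sub>m m) (0\<^sub>m m k) (0\<^sub>m k m) (1\<^sub>m k)"
  proof -
    have "- V * - adj V = V * adj V" "- V * 0\<^sub>m m m = 0\<^sub>m k m"
      using V by auto
    moreover have "- 0\<^sub>m m k = (0\<^sub>m m k :: complex mat)"
      by (rule eq_matI) auto
    ultimately show ?thesis
      unfolding adjQ unfolding Q_def using V P
      by (subst mult_four_block_mat[of _ m k _ m _ k _ _ m _ k])
        (auto simp: VV VP PV PP)
  qed
  then have UQ: "unitary_mat (m + k) (adj Q)"
    using unitary_matI[OF Q] Q by (simp add: unitary_mat_def four_block_one_mat)
  define pad where "pad g i = (if i < k then g i else 0)" for g :: "nat \<Rightarrow> real" and i
  \<comment> \<open>The lower left block of \<open>Q\<close> is zero, so the constant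
    \<open>c\<close> cannot enter the upper left corner. It stays general because \<open>d\<close>
    is padded with 0, but \<open>f \<circ> d\<close> with \<open>f 0\<close>.\<close>
  have comp: "\<exists>B C D. B \<in> carrier_mat m k \<and> C \<in> carrier_mat k m \<and> D \<in> carrier_mat k k \<and>
      adj Q * rdiag (m + k) (\<lambda>i. if i < k then g i else c) * adj (adj Q) =
        four_block_mat (adj V * rdiag k g * V) B C D" for g c
  proof -
    have diag: "rdiag (m + k) (\<lambda>i. if i < k then g i else c) =
        four_block_mat (rdiag k g) (0\<^sub>m k m) (0\<^sub>m m k) (rdiag m (\<lambda>_. c))"
      by (rule eq_matI) auto
    define V' where "V' = adj V * rdiag k g"
    have V': "V' \<in> carrier_mat m k"
      using V by (auto simp: V'_def)
    have "adj Q * rdiag (m + k) (\<lambda>i. if i < k then g i else c) =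
        four_block_mat V' (0\<^sub>m m m) (P * rdiag k g) (- V * rdiag m (\<lambda>_. c))"
      unfolding diag adjQ using V P
      by (subst mult_four_block_mat[of _ m k _ m _ k _ _ k _ m])
        (auto simp: V'_def left_add_zero_mat[of _ k m] right_add_zero_mat[of _ k k]
          right_add_zero_mat[of _ m k] intro!: cong_four_block_mat)
    then have "adj Q * rdiag (m + k) (\<lambda>i. if i < k then g i else c) * adj (adj Q) =
        four_block_mat (V' * V + 0\<^sub>m m m * 0\<^sub>m m m) (V' * P + 0\<^sub>m m m * - adj V)
          (P * rdiag k g * V + - V * rdiag m (\<lambda>_. c) * 0\<^sub>m m m)
          (P * rdiag k g * P + - V * rdiag m (\<lambda>_. c) * - adj V)"
      unfolding adj_adj unfolding Q_def using V P V'
      by (simp add: mult_four_block_mat[of _ m k _ m _ k _ _ m _ k])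
    moreover have "V' * V + 0\<^sub>m m m * 0\<^sub>m m m = adj V * rdiag k g * V"
      using V V' by (auto simp: V'_def)
    moreover have "V' * P + 0\<^sub>m m m * - adj V \<in> carrier_mat m k"
      "P * rdiag k g * V + - V * rdiag m (\<lambda>_. c) * 0\<^sub>m m m \<in> carrier_mat k m"
      "P * rdiag k g * P + - V * rdiag m (\<lambda>_. c) * - adj V \<in> carrier_mat k k"
      using V V' P by auto
    ultimately show ?thesis
      by (intro exI conjI) simp_all
  qed
  \<comment> \<open>Padding with 0 keeps the dilated matrix positive semidefinite, so operator
    convexity applies to it; the functional calculus turns the padding into
    \<open>f 0\<close>.\<close>
  let ?A = "adj Q * rdiag (m + k) (\<lambda>i. if i < k then d i else 0) * adj (adj Q)"
  obtain B C D where A: "?A = four_block_mat (adj V * rdiag k d * V) B C D" "D \<in> carrier_mat k k"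
    using comp[of d 0] by blast
  obtain B' C' D' where F: "adj Q * rdiag (m + k) (\<lambda>i. if i < k then f (d i) else f 0) * adj (adj Q) =
      four_block_mat (adj V * rdiag k (\<lambda>i. f (d i)) * V) B' C' D'" "D' \<in> carrier_mat k k"
    using comp[of "\<lambda>i. f (d i)" "f 0"] by blast
  have "f (if i < k then d i else 0) = (if i < k then f (d i) else f 0)" for i
    by simp
  then have fA: "fun_calc f ?A = four_block_mat (adj V * rdiag k (\<lambda>i. f (d i)) * V) B' C' D'"
    unfolding fun_calc_unitary_diag[OF UQ] F(1)[symmetric] by simp
  have "psd (m + k) (rdiag (m + k) (\<lambda>i. if i < k then d i else 0))"
  proof -
    let ?R = "rdiag (m + k) (\<lambda>i. if i < k then sqrt (d i) else 0)"
    have "rdiag (m + k) (\<lambda>i. if i < k then d i else 0) = adj ?R * ?R"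
      using d by (auto intro!: mat_diag_cong simp flip: of_real_mult)
    then show ?thesis
      using psd_adj_mult[of ?R "m + k" "m + k"] by simp
  qed
  from psd_congruence[OF this, of "adj (adj Q)" "m + k"] Q have "psd (m + k) ?A"
    by simp
  from operator_convex_pinching[OF f this A(1) fA _ A(2) _ F(2)] show ?thesis
    using V by (simp add: mult3_carrier[of _ m k _ k])
qed

section \<open>Stacking positive operators into an isometry\<close>

lemma sum_div_mod_eq:
  fixes h :: "nat \<Rightarrow> nat \<Rightarrow> 'a :: comm_monoid_add"
  shows "(\<Sum>a<N * m. h (a div m) (a mod m)) = (\<Sum>i<N. \<Sum>j<m. h i j)"
proof -
  have "a div m = i \<and> a mod m = a - i * m" if "i * m \<le> a" "a < i * m + m" for a i
  proof -
    have "a div m = i"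
      using that by (intro div_nat_eqI) (simp_all add: mult.commute)
    then show ?thesis
      by (simp flip: minus_div_mult_eq_mod)
  qed
  then have "(\<Sum>a\<in>{i * m..<i * m + m}. h (a div m) (a mod m)) = (\<Sum>j<m. h i j)" for i
    by (intro sum.reindex_bij_witness[of _ "\<lambda>j. i * m + j" "\<lambda>a. a - i * m"]) auto
  then show ?thesis
    by (simp flip: sum.nat_group)
qed

text \<open>A Naimark dilation: the factors of the \<open>M i\<close> are the block rows of
  \<open>V\<close>, whose row \<open>a\<close> is row \<open>a mod m\<close> of
  \<open>B (a div m)\<close>. The assumption \<open>sum_M\<close> says that \<open>V\<close> is an
  isometry, so \<open>operator_jensen_isometry\<close> applies to the diagonal matrix with the
  constant value \<open>lam i\<close> on block \<open>i\<close>.\<close>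

lemma operator_jensen:
  fixes N m :: nat
  assumes f: "operator_convex f" and M: "\<And>i. i < N \<Longrightarrow> psd m (M i)"
    and sum_M: "mat_sum m M {..<N} = 1\<^sub>m m" and lam: "\<And>i. i < N \<Longrightarrow> 0 \<le> lam i"
  shows "loewner_le m (fun_calc f (mat_sum m (\<lambda>i. complex_of_real (lam i) \<cdot>\<^sub>m M i) {..<N}))
    (mat_sum m (\<lambda>i. complex_of_real (f (lam i)) \<cdot>\<^sub>m M i) {..<N})"
proof -
  have "\<exists>B. B \<in> carrier_mat m m \<and> M i = adj B * B" if "i < N" for i
    using psd_factor[OF M[OF that]] by metis
  then obtain B where B: "\<And>i. i < N \<Longrightarrow> B i \<in> carrier_mat m m"
    and MB: "\<And>i. i < N \<Longrightarrow> M i = adj (B i) * B i"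
    by metis
  define V where "V = mat (N * m) m (\<lambda>(a, j). B (a div m) $$ (a mod m, j))"
  have V: "V \<in> carrier_mat (N * m) m"
    by (simp add: V_def)
  \<comment> \<open>One identity serves three weights: the constant 1 shows that \<open>V\<close> is
    an isometry, \<open>lam\<close> gives the argument of \<open>f\<close>, and
    \<open>f \<circ> lam\<close> gives the upper bound.\<close>
  have VgV: "adj V * rdiag (N * m) (\<lambda>a. g (a div m)) * V =
      mat_sum m (\<lambda>i. complex_of_real (g i) \<cdot>\<^sub>m M i) {..<N}" for g
  proof (rule eq_matI)
    fix i j assume "i < dim_row (mat_sum m (\<lambda>i. complex_of_real (g i) \<cdot>\<^sub>m M i) {..<N})"
      "j < dim_col (mat_sum m (\<lambda>i. complex_of_real (g i) \<cdot>\<^sub>m M i) {..<N})"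
    then have ij: "i < m" "j < m"
      by (auto simp: mat_sum_def)
    have "adj V \<in> carrier_mat m (N * m)"
      using V by simp
    then have "(adj V * rdiag (N * m) (\<lambda>a. g (a div m)) * V) $$ (i, j) =
        (\<Sum>a<N * m. cnj (V $$ (a, i)) * complex_of_real (g (a div m)) * V $$ (a, j))"
      using ij V by (simp add: mat_diag_mult_right[of _ m "N * m"] index_mult_sum del: index_mult_mat(1))
    also have "\<dots> = (\<Sum>a<N * m. cnj (B (a div m) $$ (a mod m, i)) * complex_of_real (g (a div m)) *
        B (a div m) $$ (a mod m, j))"
      using ij by (intro sum.cong) (auto simp: V_def)
    also have "\<dots> = (\<Sum>l<N. \<Sum>b<m. cnj (B l $$ (b, i)) * complex_of_real (g l) * B l $$ (b, j))"
      by (rule sum_div_mod_eq)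
    also have "\<dots> = (\<Sum>l<N. (complex_of_real (g l) \<cdot>\<^sub>m M l) $$ (i, j))"
    proof (rule sum.cong[OF refl])
      fix l assume l: "l \<in> {..<N}"
      then have "M l $$ (i, j) = (\<Sum>b<m. cnj (B l $$ (b, i)) * B l $$ (b, j))"
        using ij B[of l] by (simp add: MB index_mult_sum del: index_mult_mat(1))
      moreover have "dim_row (M l) = m" "dim_col (M l) = m"
        using M[of l] l by (auto simp: psd_def)
      ultimately show "(\<Sum>b<m. cnj (B l $$ (b, i)) * complex_of_real (g l) * B l $$ (b, j)) =
          (complex_of_real (g l) \<cdot>\<^sub>m M l) $$ (i, j)"
        using ij by (simp add: sum_distrib_left mult_ac)
    qed
    finally show "(adj V * rdiag (N * m) (\<lambda>a. g (a div m)) * V) $$ (i, j) =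
        mat_sum m (\<lambda>i. complex_of_real (g i) \<cdot>\<^sub>m M i) {..<N} $$ (i, j)"
      using ij by (simp add: mat_sum_def)
  qed (use V in \<open>auto simp: mat_sum_def\<close>)
  have "mat_sum m (\<lambda>i. complex_of_real 1 \<cdot>\<^sub>m M i) {..<N} = mat_sum m M {..<N}"
    using carrier_matD[OF psd_carrier[OF M]] by (intro eq_matI) (simp_all add: mat_sum_def)
  then have VV: "adj V * V = 1\<^sub>m m"
    using VgV[of "\<lambda>_. 1"] V sum_M right_mult_one_mat[of "adj V" m "N * m"] by simp
  have "0 \<le> lam (a div m)" if "a < N * m" for a
    using lam[of "a div m"] that by (simp add: less_mult_imp_div_less)
  then have "loewner_le m (fun_calc f (adj V * rdiag (N * m) (\<lambda>a. lam (a div m)) * V))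
      (adj V * rdiag (N * m) (\<lambda>a. f (lam (a div m))) * V)"
    by (rule operator_jensen_isometry[OF f V VV])
  then show ?thesis
    by (simp only: VgV[of lam] VgV[of "\<lambda>i. f (lam i)"])
qed

subsection \<open>Traces and inverse square roots\<close>

lemma trace_mat_comm:
  assumes "A \<in> carrier_mat n k" "B \<in> carrier_mat k n"
  shows "trace_mat (A * B) = trace_mat (B * A)"
proof -
  have "trace_mat (A * B) = (\<Sum>i<n. \<Sum>j<k. A $$ (i, j) * B $$ (j, i))"
    using assms by (simp add: trace_mat_def index_mult_sum del: index_mult_mat(1))
  also have "\<dots> = (\<Sum>j<k. \<Sum>i<n. B $$ (j, i) * A $$ (i, j))"
    by (subst sum.swap) (simp add: mult.commute)
  also have "\<dots> = trace_mat (B * A)"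
    using assms by (simp add: trace_mat_def index_mult_sum del: index_mult_mat(1))
  finally show ?thesis .
qed

lemma trace_mat_sum:
  fixes N :: nat
  assumes "\<And>k. k < N \<Longrightarrow> A k \<in> carrier_mat n n"
  shows "trace_mat (mat_sum n (\<lambda>k. c k \<cdot>\<^sub>m A k) {..<N}) = (\<Sum>k<N. c k * trace_mat (A k))"
proof -
  have "trace_mat (mat_sum n (\<lambda>k. c k \<cdot>\<^sub>m A k) {..<N}) = (\<Sum>i<n. \<Sum>k<N. (c k \<cdot>\<^sub>m A k) $$ (i, i))"
    by (simp add: trace_mat_def mat_sum_def)
  also have "\<dots> = (\<Sum>k<N. \<Sum>i<n. (c k \<cdot>\<^sub>m A k) $$ (i, i))"
    by (rule sum.swap)
  also have "\<dots> = (\<Sum>k<N. c k * trace_mat (A k))"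
    using carrier_matD[OF assms] by (intro sum.cong) (simp_all add: trace_mat_def sum_distrib_left)
  finally show ?thesis .
qed

lemma mat_sum_carrier [simp]: "mat_sum n A I \<in> carrier_mat n n"
  by (simp add: mat_sum_def)

lemma mat_sum_cong: "(\<And>k. k \<in> I \<Longrightarrow> A k = B k) \<Longrightarrow> mat_sum n A I = mat_sum n B I"
  by (simp add: mat_sum_def)

lemma linear_map_mat_sum:
  fixes N :: nat
  assumes L: "linear_map_mat n m L" and A: "\<And>k. k < N \<Longrightarrow> A k \<in> carrier_mat n n"
  shows "L (mat_sum n (\<lambda>k. c k \<cdot>\<^sub>m A k) {..<N}) = mat_sum m (\<lambda>k. c k \<cdot>\<^sub>m L (A k)) {..<N}"
  using A
proof (induction N)
  case 0
  have "L (0 \<cdot>\<^sub>m 0\<^sub>m n n) = 0 \<cdot>\<^sub>m L (0\<^sub>m n n)" and "L (0\<^sub>m n n) \<in> carrier_mat m m"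
    using L zero_carrier_mat[of n n] unfolding linear_map_mat_def by blast+
  then have "L (0\<^sub>m n n) = 0\<^sub>m m m"
    by (auto simp: mat_eq_iff)
  moreover have "mat_sum k (\<lambda>k. c k \<cdot>\<^sub>m B k) {..<0} = 0\<^sub>m k k" for k B
    by (rule eq_matI) (auto simp: mat_sum_def)
  ultimately show ?case
    by simp
next
  case (Suc N)
  have step: "mat_sum k (\<lambda>k. c k \<cdot>\<^sub>m B k) {..<Suc N} = mat_sum k (\<lambda>k. c k \<cdot>\<^sub>m B k) {..<N} + c N \<cdot>\<^sub>m B N"
    if "B N \<in> carrier_mat k k" for k B
    using that by (intro eq_matI) (auto simp: mat_sum_def)
  have AN: "A N \<in> carrier_mat n n"
    by (simp add: Suc.prems)
  then have "L (A N) \<in> carrier_mat m m"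
    using L by (simp add: linear_map_mat_def)
  moreover have "c N \<cdot>\<^sub>m A N \<in> carrier_mat n n"
    using AN by simp
  ultimately show ?case
    using L AN Suc by (simp add: step linear_map_mat_def)
qed

text \<open>Lets \<open>linear_map_mat_sum\<close>, which is also used for the channel, carry
  multiplication by square roots from both sides through a weighted sum.\<close>

lemma linear_map_mat_mult:
  assumes C: "C \<in> carrier_mat m n" and D: "D \<in> carrier_mat n m"
  shows "linear_map_mat n m (\<lambda>X. C * X * D)"
proof -
  have "C * (X + Y) * D = C * X * D + C * Y * D"
    if "X \<in> carrier_mat n n" "Y \<in> carrier_mat n n" for X Y
  proof -
    have "C * (X + Y) = C * X + C * Y"
      using C that by (rule mult_add_distrib_mat)
    then show ?thesis
      using C D that by (simp add: add_mult_distrib_mat[of _ m n _ _ m])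
  qed
  moreover have "C * (c \<cdot>\<^sub>m X) * D = c \<cdot>\<^sub>m (C * X * D)" if "X \<in> carrier_mat n n" for X c
  proof -
    have "C * (c \<cdot>\<^sub>m X) = c \<cdot>\<^sub>m (C * X)"
      using C that by (rule mult_smult_distrib)
    then show ?thesis
      using C D that by (simp add: mult_smult_assoc_mat[of _ m n _ m])
  qed
  ultimately show ?thesis
    using C D by (auto simp: linear_map_mat_def intro: mult3_carrier)
qed

lemma psd_smult:
  assumes "psd n A" "0 \<le> c"
  shows "psd n (complex_of_real c \<cdot>\<^sub>m A)"
proof -
  obtain B where B: "B \<in> carrier_mat n n" "A = adj B * B"
    using psd_factor[OF assms(1)] by blast
  let ?C = "complex_of_real (sqrt c) \<cdot>\<^sub>m B"
  have "adj ?C = complex_of_real (sqrt c) \<cdot>\<^sub>m adj B"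
    by (rule eq_matI) auto
  then have "adj ?C * ?C = complex_of_real (sqrt c) \<cdot>\<^sub>m (complex_of_real (sqrt c) \<cdot>\<^sub>m A)"
    using B mult_smult_assoc_mat[of "adj B" n n ?C n] mult_smult_distrib[of "adj B" n n B n] by simp
  also have "\<dots> = complex_of_real c \<cdot>\<^sub>m A"
    using assms(2) by (intro eq_matI) (simp_all flip: of_real_mult mult.assoc)
  finally have "adj ?C * ?C = complex_of_real c \<cdot>\<^sub>m A" .
  then show ?thesis
    using psd_adj_mult[of ?C n n] B(1) by simp
qed

section \<open>Invertible positive matrices and their square roots\<close>

lemma invertible_mat_left_inverse:
  assumes "invertible_mat A" "A \<in> carrier_mat n n"
  obtains C where "C \<in> carrier_mat n n" "C * A = 1\<^sub>m n"
proof -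
  obtain C where C: "A * C = 1\<^sub>m n" "C * A = 1\<^sub>m (dim_row C)"
    using assms by (auto simp: invertible_mat_def inverts_mat_def)
  have "dim_col C = n"
    using arg_cong[OF C(1), of dim_col] by simp
  moreover have "dim_row C = n"
    using arg_cong[OF C(2), of dim_col] assms(2) by simp
  ultimately show ?thesis
    using C that by auto
qed

text \<open>With \<open>A = adj B * B\<close>, the diagonal entry is the squared norm of column
  \<open>i\<close> of \<open>G = B * U\<close>. Were it zero, that column would vanish, although
  \<open>G\<close> has the left inverse \<open>adj U * C * adj B\<close>, where \<open>C\<close>
  inverts \<open>A\<close>. This yields positivity both of the eigenvalues of \<open>A\<close> and
  of the numbers \<open>s i\<close>.\<close>

lemma psd_invertible_unitary_pos:
  assumes A: "psd n A" "invertible_mat A" and U: "unitary_mat n U" and i: "i < n"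
  shows "0 < Re ((adj U * A * U) $$ (i, i))"
proof (rule ccontr)
  assume neg: "\<not> ?thesis"
  note UD = unitary_matD[OF U]
  obtain B where B: "B \<in> carrier_mat n n" "A = adj B * B"
    using psd_factor[OF A(1)] by blast
  obtain C where C: "C \<in> carrier_mat n n" "C * A = 1\<^sub>m n"
    using invertible_mat_left_inverse[OF A(2) psd_carrier[OF A(1)]] by metis
  define G where "G = B * U"
  have G: "G \<in> carrier_mat n n"
    using B UD by (simp add: G_def)
  have "adj U * A * U = adj G * G"
    using B UD(2,3) by (simp add: G_def adj_mult mat_mult_assoc)
  then have "(\<Sum>k<n. (cmod (G $$ (k, i)))\<^sup>2) \<le> 0"
    using neg i G by (simp add: index_adj_mult_self del: index_mult_mat(1))
  moreover have "0 \<le> (\<Sum>k<n. (cmod (G $$ (k, i)))\<^sup>2)"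
    by (simp add: sum_nonneg)
  ultimately have "(\<Sum>k<n. (cmod (G $$ (k, i)))\<^sup>2) = 0"
    by simp
  then have G0: "G $$ (k, i) = 0" if "k < n" for k
    using that by (subst (asm) sum_nonneg_eq_0_iff) auto
  have "(adj U * C * adj B) * G = 1\<^sub>m n"
  proof -
    have "(adj U * C * adj B) * G = adj U * (C * A) * U"
      using B C(1) UD(2,3) by (simp add: G_def mat_mult_assoc)
    then show ?thesis
      using UD by (simp add: C(2))
  qed
  moreover have "((adj U * C * adj B) * G) $$ (i, i) = 0"
    using i G B C(1) UD(2,3) G0 by (subst index_mult_sum) simp_all
  ultimately show False
    using i by simp
qed

lemma psd_invertible_diagonalizable:
  assumes "psd n A" "invertible_mat A"
  obtains U d where "unitary_mat n U" "\<And>i. i < n \<Longrightarrow> 0 < d i" "A = U * rdiag n d * adj U"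
proof -
  obtain U d where U: "unitary_mat n U" and A: "A = U * rdiag n d * adj U"
    using psd_diagonalizable[OF assms(1)] by metis
  note UD = unitary_matD[OF U]
  have "adj U * A * U = rdiag n d"
    using UD(2,3)
    by (simp add: A mat_mult_assoc mat_mult_cancel[OF UD(5)] UD(5) right_mult_one_mat[of _ n])
  then have "0 < d i" if "i < n" for i
    using psd_invertible_unitary_pos[OF assms U that] that by simp
  then show ?thesis
    using that U A by blast
qed

lemma unitary_diag_mult:
  assumes "unitary_mat n U"
  shows "(U * rdiag n d * adj U) * (U * rdiag n e * adj U) = U * rdiag n (\<lambda>i. d i * e i) * adj U"
proof -
  note UD = unitary_matD[OF assms]
  have "(U * rdiag n d * adj U) * (U * rdiag n e * adj U) =
      U * (rdiag n d * rdiag n e) * adj U"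
    using UD(2,3) by (simp add: mat_mult_assoc mat_mult_cancel[OF UD(5)] del: mat_diag_diag)
  then show ?thesis
    by simp
qed

lemma unitary_diag_one: "unitary_mat n U \<Longrightarrow> (\<And>i. i < n \<Longrightarrow> d i = 1) \<Longrightarrow> U * rdiag n d * adj U = 1\<^sub>m n"
  using mat_diag_cong[of n "\<lambda>i. complex_of_real (d i)" "\<lambda>_. 1"] right_mult_one_mat[of U n n]
  by (simp add: unitary_matD)

text \<open>Cyclicity reduces the trace to the diagonal of \<open>adj U * A * U\<close>. For
  \<open>A = \<sigma>\<close> and the basis \<open>u\<close> this diagonal consists of the
  \<open>s i\<close>; for \<open>A = 1\<close> it consists of ones.\<close>

lemma trace_unitary_diag_mult:
  assumes U: "unitary_mat n U" and A: "A \<in> carrier_mat n n"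
  shows "trace_mat (U * rdiag n d * adj U * A) = (\<Sum>i<n. complex_of_real (d i) * ((A *\<^sub>v col U i) \<bullet>c col U i))"
proof -
  note UD = unitary_matD[OF U]
  have "U * rdiag n d * adj U * A = U * (rdiag n d * adj U * A)"
    using UD(2,3) A by (simp add: mat_mult_assoc)
  also have "trace_mat \<dots> = trace_mat (rdiag n d * adj U * A * U)"
    using UD(1) A by (intro trace_mat_comm[of _ n n] mult3_carrier[of _ n n _ n]) simp_all
  also have "rdiag n d * adj U * A * U = rdiag n d * (adj U * A * U)"
    using UD(2,3) A by (simp add: mat_mult_assoc)
  also have "trace_mat \<dots> = (\<Sum>i<n. complex_of_real (d i) * (adj U * A * U) $$ (i, i))"
    using mult3_carrier[of "adj U" n n A n U n] UD(1) A
    by (simp add: mat_diag_mult_left[of _ n n] trace_mat_def del: index_mult_mat(1))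
  also have "\<dots> = (\<Sum>i<n. complex_of_real (d i) * ((A *\<^sub>v col U i) \<bullet>c col U i))"
    using quadratic_form_index[OF A UD(1)] by (intro sum.cong refl) simp
  finally show ?thesis .
qed

text \<open>Both matrices are diagonal in the same basis. Strict positivity of the eigenvalues is
  essential: since \<open>1 / sqrt 0 = 0\<close>, a zero eigenvalue would prevent \<open>T\<close>
  from inverting \<open>S\<close>.\<close>

lemma psd_invertible_sqrt:
  assumes "psd n A" "invertible_mat A"
  defines "S \<equiv> fun_calc sqrt A" and "T \<equiv> fun_calc (\<lambda>x. 1 / sqrt x) A"
  shows "S \<in> carrier_mat n n" "T \<in> carrier_mat n n" "adj S = S" "adj T = T"
    "S * S = A" "S * T = 1\<^sub>m n" "T * S = 1\<^sub>m n"
proof -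
  obtain U d where U: "unitary_mat n U" and d: "\<And>i. i < n \<Longrightarrow> 0 < d i" and A: "A = U * rdiag n d * adj U"
    using psd_invertible_diagonalizable[OF assms(1,2)] by metis
  note UD = unitary_matD[OF U]
  have S: "S = U * rdiag n (\<lambda>i. sqrt (d i)) * adj U" and T: "T = U * rdiag n (\<lambda>i. 1 / sqrt (d i)) * adj U"
    unfolding S_def T_def A by (rule fun_calc_unitary_diag[OF U])+
  show "S \<in> carrier_mat n n" "T \<in> carrier_mat n n"
    unfolding S T by (rule unitary_diag_carrier[OF U])+
  have "adj (U * rdiag n e * adj U) = U * rdiag n e * adj U" for e
    using UD(2,3) by (simp add: adj_mult mat_mult_assoc)
  then show "adj S = S" "adj T = T"
    by (simp_all only: S T)
  have "rdiag n (\<lambda>i. sqrt (d i) * sqrt (d i)) = rdiag n d"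
    using d by (intro mat_diag_cong) (simp add: less_imp_le)
  then show "S * S = A"
    by (simp add: S A unitary_diag_mult[OF U])
  have "sqrt (d i) * (1 / sqrt (d i)) = 1" "1 / sqrt (d i) * sqrt (d i) = 1" if "i < n" for i
    using d[OF that] by simp_all
  then show "S * T = 1\<^sub>m n" "T * S = 1\<^sub>m n"
    unfolding S T unitary_diag_mult[OF U] by (auto intro!: unitary_diag_one[OF U])
qed

subsection \<open>Divergence of a mixture\<close>

lemma trace_mat_minus:
  "A \<in> carrier_mat n n \<Longrightarrow> B \<in> carrier_mat n n \<Longrightarrow> trace_mat (A - B) = trace_mat A - trace_mat B"
  by (simp add: trace_mat_def sum_subtractf)

lemma trace_conj_mono:
  assumes "loewner_le n A B" "S \<in> carrier_mat n n" "adj S = S"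
  shows "Re (trace_mat (S * A * S)) \<le> Re (trace_mat (S * B * S))"
proof -
  have AB: "A \<in> carrier_mat n n" "B \<in> carrier_mat n n" "psd n (B - A)"
    using assms(1) by (auto simp: loewner_le_def)
  have "S * (B - A) * S = S * B * S - S * A * S"
  proof -
    have "S * (B - A) = S * B - S * A"
      using assms(2) AB by (intro mult_minus_distrib_mat)
    then show ?thesis
      using assms(2) AB by (simp add: minus_mult_distrib_mat[of _ n n _ _ n])
  qed
  then have "trace_mat (S * (B - A) * S) = trace_mat (S * B * S) - trace_mat (S * A * S)"
    using assms(2) AB by (simp add: trace_mat_minus[of _ n] mult3_carrier[of _ n n _ n])
  moreover have "0 \<le> Re (trace_mat (S * (B - A) * S))"
    using psd_trace[OF psd_congruence[OF AB(3) assms(2)]] by (simp add: assms(3))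
  ultimately show ?thesis
    by simp
qed

text \<open>The data processing bound with the channel replaced by its outputs \<open>A i\<close>,
  which are states. Only the mixture \<open>X\<close> has to be invertible, not the single
  \<open>A i\<close>.\<close>

lemma max_f_divergence_mixture_le:
  fixes N m :: nat
  assumes f: "operator_convex f"
    and A: "\<And>i. i < N \<Longrightarrow> psd m (A i)" and trA: "\<And>i. i < N \<Longrightarrow> trace_mat (A i) = 1"
    and s: "\<And>i. i < N \<Longrightarrow> 0 \<le> s i" and lam: "\<And>i. i < N \<Longrightarrow> 0 \<le> lam i"
    and X: "X = mat_sum m (\<lambda>i. complex_of_real (s i) \<cdot>\<^sub>m A i) {..<N}"
    and psdX: "psd m X" and invX: "invertible_mat X"
  shows "max_f_divergence f (mat_sum m (\<lambda>i. complex_of_real (lam i * s i) \<cdot>\<^sub>m A i) {..<N}) X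
    \<le> (\<Sum>i<N. s i * f (lam i))"
proof -
  define S where "S = fun_calc sqrt X"
  define T where "T = fun_calc (\<lambda>x. 1 / sqrt x) X"
  note ST = psd_invertible_sqrt[OF psdX invX, folded S_def T_def]
  have dims: "dim_row S = m" "dim_col S = m" "dim_row T = m" "dim_col T = m"
    using ST(1,2) by auto
  note AC = psd_carrier[OF A]
  define M where "M i = complex_of_real (s i) \<cdot>\<^sub>m (T * A i * T)" for i
  have TAT: "T * A i * T \<in> carrier_mat m m" if "i < N" for i
    using AC[OF that] ST(2) by (intro mult3_carrier)
  have M: "psd m (M i)" if "i < N" for i
    using psd_smult[OF psd_congruence[OF A[OF that] ST(2)] s[OF that]] by (simp add: M_def ST(4))
  have conj_T: "T * mat_sum m (\<lambda>i. c i \<cdot>\<^sub>m A i) {..<N} * T =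
      mat_sum m (\<lambda>i. c i \<cdot>\<^sub>m (T * A i * T)) {..<N}" for c
    by (rule linear_map_mat_sum[OF linear_map_mat_mult[OF ST(2,2)] AC])
  have "mat_sum m M {..<N} = T * X * T"
    unfolding X conj_T by (rule mat_sum_cong) (simp add: M_def)
  also have "\<dots> = (T * S) * (S * T)"
    using dims by (simp add: ST(5)[symmetric] mat_mult_assoc)
  finally have sum_M: "mat_sum m M {..<N} = 1\<^sub>m m"
    by (simp add: ST(6,7))
  \<comment> \<open>The weight \<open>s i\<close> inside \<open>M i\<close> merges with
    \<open>g i\<close>: \<open>g = lam\<close> produces the normalised first argument of the
    divergence, \<open>g = f \<circ> lam\<close> the Jensen bound.\<close>
  have scaled: "mat_sum m (\<lambda>i. complex_of_real (g i) \<cdot>\<^sub>m M i) {..<N} =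
      mat_sum m (\<lambda>i. complex_of_real (g i * s i) \<cdot>\<^sub>m (T * A i * T)) {..<N}" for g
    by (intro mat_sum_cong) (rule eq_matI, auto simp: M_def)
  define R where "R = mat_sum m (\<lambda>i. complex_of_real (lam i * s i) \<cdot>\<^sub>m A i) {..<N}"
  define Y where "Y = mat_sum m (\<lambda>i. complex_of_real (f (lam i)) \<cdot>\<^sub>m M i) {..<N}"
  have "T * R * T = mat_sum m (\<lambda>i. complex_of_real (lam i) \<cdot>\<^sub>m M i) {..<N}"
    unfolding R_def conj_T scaled ..
  then have "loewner_le m (fun_calc f (T * R * T)) Y"
    using operator_jensen[OF f M sum_M lam] by (simp add: Y_def)
  from trace_conj_mono[OF this ST(1,3)]
  have "max_f_divergence f R X \<le> Re (trace_mat (S * Y * S))"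
    by (simp add: max_f_divergence_def S_def T_def Let_def)
  also have "S * Y * S = mat_sum m (\<lambda>i. complex_of_real (f (lam i) * s i) \<cdot>\<^sub>m (S * (T * A i * T) * S)) {..<N}"
    unfolding Y_def scaled
    by (rule linear_map_mat_sum[OF linear_map_mat_mult[OF ST(1,1)] TAT])
  \<comment> \<open>Since \<open>S * T\<close> and \<open>T * S\<close> are the identity, the outer
    square roots undo the normalisation and leave the matrices \<open>A i\<close> of trace
    1.\<close>
  also have "\<dots> = mat_sum m (\<lambda>i. complex_of_real (f (lam i) * s i) \<cdot>\<^sub>m A i) {..<N}"
  proof (rule mat_sum_cong)
    fix i assume "i \<in> {..<N}"
    then have Ai: "A i \<in> carrier_mat m m"
      using AC by simp
    have "S * (T * A i * T) * S = (S * T) * A i * (T * S)"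
      using dims Ai by (simp add: mat_mult_assoc)
    then show "complex_of_real (f (lam i) * s i) \<cdot>\<^sub>m (S * (T * A i * T) * S) =
        complex_of_real (f (lam i) * s i) \<cdot>\<^sub>m A i"
      using Ai by (simp add: ST(6,7))
  qed
  also have "trace_mat \<dots> = (\<Sum>i<N. complex_of_real (s i * f (lam i)))"
    using trA by (simp add: trace_mat_sum[OF AC] mult.commute)
  finally show ?thesis
    by (simp add: R_def)
qed

section \<open>Rank-one projections, positivity of channels, orthonormal bases\<close>

lemma psd_ketbra:
  assumes "u \<in> carrier_vec n"
  shows "psd n (ketbra u u)"
proof -
  let ?B = "mat 1 n (\<lambda>(_, j). cnj (u $ j))"
  have "ketbra u u = adj ?B * ?B"
    using assms by (intro eq_matI) (auto simp: ketbra_def index_mult_sum simp del: index_mult_mat(1))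
  then show ?thesis
    using psd_adj_mult[of ?B 1 n] by simp
qed

lemma trace_ketbra: "trace_mat (ketbra u u) = u \<bullet>c u"
  by (simp add: trace_mat_def ketbra_def scalar_prod_def atLeast0LessThan)

text \<open>With a single block the ampliation is the map itself, so complete positivity at
  \<open>k = 1\<close> is ordinary positivity.\<close>

lemma ampliation_one:
  assumes "linear_map_mat n m W" "X \<in> carrier_mat n n"
  shows "ampliation 1 n m W X = W X"
proof -
  have "block n X 0 0 = X"
    using assms(2) by (intro eq_matI) (auto simp: block_def)
  moreover have "W X \<in> carrier_mat m m"
    using assms by (simp add: linear_map_mat_def)
  ultimately show ?thesis
    by (intro eq_matI) (auto simp: ampliation_def)
qed

lemma quantum_channel_psd:
  assumes "quantum_channel n m W" "psd n X"
  shows "psd m (W X)"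
proof -
  have "psd (1 * m) (ampliation 1 n m W X)"
    using assms unfolding quantum_channel_def completely_positive_def by (metis mult_1)
  then show ?thesis
    using assms ampliation_one[of n m W X] by (simp add: quantum_channel_def psd_def)
qed

text \<open>Turns the spectral sums of the theorem into the form
  \<open>U * rdiag n d * adj U\<close>, on which the functional calculus can be evaluated.\<close>

lemma unitary_of_orthonormal:
  assumes "\<And>i. i < n \<Longrightarrow> u i \<in> carrier_vec n"
    and "\<And>i j. i < n \<Longrightarrow> j < n \<Longrightarrow> u i \<bullet>c u j = (if i = j then 1 else 0)"
  defines "U \<equiv> mat n n (\<lambda>(i, j). u j $ i)"
  shows "unitary_mat n U" "\<And>i. i < n \<Longrightarrow> col U i = u i"
    "mat_sum n (\<lambda>i. complex_of_real (d i) \<cdot>\<^sub>m ketbra (u i) (u i)) {..<n} = U * rdiag n d * adj U"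
proof -
  have U: "U \<in> carrier_mat n n"
    by (simp add: U_def)
  show col: "col U i = u i" if "i < n" for i
    using that assms(1)[OF that] by (intro eq_vecI) (auto simp: U_def)
  have "adj U * U = 1\<^sub>m n"
    using U by (intro eq_matI) (auto simp: index_adj_mult col assms(2) simp del: index_mult_mat(1))
  then show "unitary_mat n U"
    using unitary_matI[OF U] by simp
  have dim_u: "dim_vec (u i) = n" if "i < n" for i
    using assms(1)[OF that] by simp
  show "mat_sum n (\<lambda>i. complex_of_real (d i) \<cdot>\<^sub>m ketbra (u i) (u i)) {..<n} = U * rdiag n d * adj U"
    unfolding mat_diag_mult_right[OF U] using dim_u
    by (intro eq_matI)
      (auto simp: mat_sum_def ketbra_def index_mult_sum U_def mult_ac
        simp del: index_mult_mat(1) intro!: sum.cong)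
qed

theorem theorem2:
  fixes f :: "real \<Rightarrow> real"
    and n m :: nat
    and \<rho> \<sigma> R S :: "complex mat"
    and lam r s :: "nat \<Rightarrow> real"
    and u :: "nat \<Rightarrow> complex vec"
    and W :: "complex mat \<Rightarrow> complex mat"
  assumes "operator_convex f" and "f 1 = 0"
    and "quantum_state n \<rho>" and "quantum_state n \<sigma>" and "invertible_mat \<sigma>"
    and "\<And>i. i < n \<Longrightarrow> 0 \<le> lam i"
    and "\<And>i. i < n \<Longrightarrow> u i \<in> carrier_vec n"
    and "\<And>i j. i < n \<Longrightarrow> j < n \<Longrightarrow> u i \<bullet>c u j = (if i = j then 1 else 0)"
    and "fun_calc (\<lambda>x. 1 / sqrt x) \<sigma> * \<rho> * fun_calc (\<lambda>x. 1 / sqrt x) \<sigma> =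
         mat_sum n (\<lambda>i. complex_of_real (lam i) \<cdot>\<^sub>m ketbra (u i) (u i)) {..<n}"
    and "\<And>i. i < n \<Longrightarrow> s i = Re ((\<sigma> *\<^sub>v u i) \<bullet>c u i)"
    and "\<And>i. i < n \<Longrightarrow> r i = lam i * s i"
    and "R = mat_sum n (\<lambda>i. complex_of_real (r i) \<cdot>\<^sub>m ketbra (u i) (u i)) {..<n}"
    and "S = mat_sum n (\<lambda>i. complex_of_real (s i) \<cdot>\<^sub>m ketbra (u i) (u i)) {..<n}"
    and "quantum_channel n m W" and "invertible_mat (W S)"
  shows "(\<forall>i<n. 0 \<le> r i) \<and> (\<Sum>i<n. r i) = 1 \<and> (\<forall>i<n. 0 \<le> s i) \<and> (\<Sum>i<n. s i) = 1 \<and>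
         max_f_divergence f (W R) (W S) \<le> max_f_divergence f R S \<and>
         max_f_divergence f (W R) (W S) \<le> max_f_divergence f \<rho> \<sigma>"
proof -
  define U where "U = mat n n (\<lambda>(i, j). u j $ i)"
  note UU = unitary_of_orthonormal[OF assms(7,8), folded U_def]
  note U = UU(1) and UD = unitary_matD[OF UU(1)]
  define Q where "Q = fun_calc sqrt \<sigma>"
  define T where "T = fun_calc (\<lambda>x. 1 / sqrt x) \<sigma>"
  have \<sigma>: "psd n \<sigma>" "trace_mat \<sigma> = 1" and \<rho>: "psd n \<rho>" "trace_mat \<rho> = 1"
    using assms(3,4) by (auto simp: quantum_state_def)
  note QT = psd_invertible_sqrt[OF \<sigma>(1) assms(5), folded Q_def T_def]
  have dims: "dim_row Q = n" "dim_col Q = n" "dim_row T = n" "dim_col T = n"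
    "dim_row \<rho> = n" "dim_col \<rho> = n"
    using QT(1,2) psd_carrier[OF \<rho>(1)] by auto
  have R: "R = U * rdiag n r * adj U" and S: "S = U * rdiag n s * adj U"
    and X: "T * \<rho> * T = U * rdiag n lam * adj U"
    using assms(9,12,13) by (simp_all add: UU(3) T_def)
  \<comment> \<open>Strict positivity comes from the invertibility of \<sigma> and permits division
    by \<open>s i\<close> in the divergence of the commuting pair.\<close>
  have spos: "0 < s i" if "i < n" for i
    using psd_invertible_unitary_pos[OF \<sigma>(1) assms(5) U that] that
      quadratic_form_index[OF psd_carrier[OF \<sigma>(1)] UD(1) that that]
    by (simp add: assms(10) UU(2) del: index_mult_mat(1))
  \<comment> \<open>Used with three choices of \<open>d\<close>: the constant 1 for the sum of
    \<open>s\<close>, \<open>lam\<close> for the sum of \<open>r\<close>, and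
    \<open>f \<circ> lam\<close> for the divergence of \<rho> and \<sigma>.\<close>
  have tr_\<sigma>: "Re (trace_mat (U * rdiag n d * adj U * \<sigma>)) = (\<Sum>i<n. d i * s i)" for d
    by (simp add: trace_unitary_diag_mult[OF U psd_carrier[OF \<sigma>(1)]] UU(2) assms(10))
  have "U * rdiag n (\<lambda>_. 1) * adj U = 1\<^sub>m n"
    using unitary_diag_one[OF U, of "\<lambda>_. 1"] by simp
  then have sum_s: "(\<Sum>i<n. s i) = 1"
    using tr_\<sigma>[of "\<lambda>_. 1"] psd_carrier[OF \<sigma>(1)] \<sigma>(2) by simp
  \<comment> \<open>Writing \<sigma> as \<open>Q * Q\<close> and cancelling \<open>T * Q\<close>,
    then cycling and cancelling \<open>Q * T\<close>, leaves the trace of \<rho>.\<close>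
  have "trace_mat (T * \<rho> * T * \<sigma>) = trace_mat ((T * \<rho>) * Q)"
    using dims by (simp add: QT(5)[symmetric] mat_mult_assoc mat_mult_cancel[OF QT(7)])
  also have "\<dots> = trace_mat (Q * (T * \<rho>))"
    using QT(1,2) psd_carrier[OF \<rho>(1)] by (intro trace_mat_comm[of _ n n]) auto
  also have "\<dots> = 1"
    using dims \<rho>(2) by (simp add: mat_mult_cancel[OF QT(6)])
  finally have sum_r: "(\<Sum>i<n. r i) = 1"
    using tr_\<sigma>[of lam] by (simp add: X assms(11))
  have D\<rho>: "max_f_divergence f \<rho> \<sigma> = (\<Sum>i<n. s i * f (lam i))"
  proof -
    define F where "F = U * rdiag n (\<lambda>i. f (lam i)) * adj U"
    have F: "F \<in> carrier_mat n n"
      unfolding F_def by (rule unitary_diag_carrier[OF U])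
    have "max_f_divergence f \<rho> \<sigma> = Re (trace_mat (Q * F * Q))"
      by (simp add: max_f_divergence_def Let_def Q_def[symmetric] T_def[symmetric] X
          fun_calc_unitary_diag[OF U] F_def)
    also have "Q * F * Q = Q * (F * Q)"
      using F dims by (simp add: mat_mult_assoc)
    also have "trace_mat \<dots> = trace_mat (F * Q * Q)"
      using F QT(1) by (intro trace_mat_comm[of _ n n]) auto
    also have "F * Q * Q = F * \<sigma>"
      using F dims by (simp add: mat_mult_assoc QT(5))
    finally show ?thesis
      by (simp add: F_def tr_\<sigma> mult.commute)
  qed
  have DR: "max_f_divergence f R S = (\<Sum>i<n. s i * f (lam i))"
  proof -
    \<comment> \<open>Both states are diagonal in the basis \<open>U\<close>, so the divergence is
      computed on eigenvalues, and the ratios \<open>r i / s i\<close> return the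
      \<open>lam i\<close>. The products keep the shape in which \<open>unitary_diag_mult\<close>
      delivers them, so that they can be rewritten afterwards.\<close>
    have "rdiag n (\<lambda>i. 1 / sqrt (s i) * r i * (1 / sqrt (s i))) = rdiag n lam"
    proof (rule mat_diag_cong)
      fix i assume i: "i < n"
      have "sqrt (s i) * sqrt (s i) = s i"
        using spos[OF i] by simp
      then show "complex_of_real (1 / sqrt (s i) * r i * (1 / sqrt (s i))) = complex_of_real (lam i)"
        using spos[OF i] assms(11)[OF i] by (simp add: field_simps)
    qed
    moreover have "rdiag n (\<lambda>i. sqrt (s i) * f (lam i) * sqrt (s i)) = rdiag n (\<lambda>i. s i * f (lam i))"
    proof (rule mat_diag_cong)
      fix i assume i: "i < n"
      have "sqrt (s i) * sqrt (s i) = s i"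
        using spos[OF i] by simp
      then have "sqrt (s i) * f (lam i) * sqrt (s i) = s i * f (lam i)"
        by (metis mult.assoc mult.commute)
      then show "complex_of_real (sqrt (s i) * f (lam i) * sqrt (s i)) = complex_of_real (s i * f (lam i))"
        by (rule arg_cong)
    qed
    ultimately have "max_f_divergence f R S = Re (trace_mat (U * rdiag n (\<lambda>i. s i * f (lam i)) * adj U))"
      by (simp only: max_f_divergence_def Let_def R S fun_calc_unitary_diag[OF U] unitary_diag_mult[OF U])
    \<comment> \<open>The identity factor brings the trace into the form of
      \<open>trace_unitary_diag_mult\<close>; the quadratic forms are then the squared norms of the
      \<open>u i\<close>, all equal to 1.\<close>
    also have "U * rdiag n (\<lambda>i. s i * f (lam i)) * adj U = U * rdiag n (\<lambda>i. s i * f (lam i)) * adj U * 1\<^sub>m n"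
      using UD(2,3) by (intro right_mult_one_mat[symmetric, of _ n]) auto
    also have "trace_mat \<dots> = (\<Sum>i<n. complex_of_real (s i * f (lam i)) * ((1\<^sub>m n *\<^sub>v col U i) \<bullet>c col U i))"
      by (rule trace_unitary_diag_mult[OF U one_carrier_mat])
    also have "\<dots> = (\<Sum>i<n. complex_of_real (s i * f (lam i)))"
      using assms(7,8) by (intro sum.cong) (simp_all add: UU(2))
    finally show ?thesis
      by simp
  qed
  have W: "linear_map_mat n m W" and WT: "trace_preserving n W"
    using assms(14) by (auto simp: quantum_channel_def)
  note ketbra = psd_ketbra[OF assms(7)]
  have W_sum: "W (mat_sum n (\<lambda>i. c i \<cdot>\<^sub>m ketbra (u i) (u i)) {..<n}) =
      mat_sum m (\<lambda>i. c i \<cdot>\<^sub>m W (ketbra (u i) (u i))) {..<n}" for c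
    by (rule linear_map_mat_sum[OF W psd_carrier[OF ketbra]])
  have WA: "psd m (W (ketbra (u i) (u i)))" "trace_mat (W (ketbra (u i) (u i))) = 1" if "i < n" for i
    using quantum_channel_psd[OF assms(14) ketbra[OF that]] WT psd_carrier[OF ketbra[OF that]] that
    by (simp_all add: trace_preserving_def trace_ketbra assms(8))
  have "psd n S"
  proof -
    have "rdiag n s = adj (rdiag n (\<lambda>i. sqrt (s i))) * rdiag n (\<lambda>i. sqrt (s i))"
      using spos by (auto intro!: mat_diag_cong simp: less_imp_le simp flip: of_real_mult)
    then have "psd n (rdiag n s)"
      using psd_adj_mult[of "rdiag n (\<lambda>i. sqrt (s i))" n n] by simp
    from psd_congruence[OF this, of "adj U" n] show ?thesis
      using UD(1) by (simp add: S)
  qed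
  then have psdWS: "psd m (W S)"
    by (rule quantum_channel_psd[OF assms(14)])
  have "W R = mat_sum m (\<lambda>i. complex_of_real (lam i * s i) \<cdot>\<^sub>m W (ketbra (u i) (u i))) {..<n}"
    unfolding assms(12) W_sum by (intro mat_sum_cong) (simp add: assms(11))
  then have "max_f_divergence f (W R) (W S) \<le> (\<Sum>i<n. s i * f (lam i))"
    using max_f_divergence_mixture_le[OF assms(1) WA less_imp_le[OF spos] assms(6) _ psdWS assms(15)]
    by (simp add: assms(13) W_sum)
  then show ?thesis
    using spos sum_s sum_r assms(6,11) by (auto simp: D\<rho> DR less_imp_le)
qed

end
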